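(* Let $k$ be a field, $S=k[x_1,\dots,x_n]$, let $I\subset(x_1,\dots,x_n)^2$ be a symmetric monomial ideal with set of generating partitions $\Lambda(I)$, and $R=S/I$. Then all products of monomial cycles (of homological degree at least one) vanish in the Koszul homology $H_*(K^R)$ if and only if for each $2\le p\le n$ at least one of the following holds: (1) For every $\lambda\in\Lambda(I)$ of length at most $\lfloor p/2\rfloor$ whose first term $\lambda_1$ is minimal among the first terms of all partitions in $\Lambda(I)$ of length at most $\lceil p/2\rceil$, one has $\lambda_1=\lambda_2$. (2) There exists $\mu\in\Lambda(I)$ with $\lceil p/2\rceil<\ell(\mu)\le p$ such that $\mu_1$ is smaller than the minimal first term among partitions of length at most $\lceil p/2\rceil$ in $\Lambda(I)$.
   Context: A symmetric monomial ideal is a monomial ideal of $S$ that is stable under all permutations of the variables. A partition is $\lambda=(\lambda_1,\dots,\lambda_n)\in\mathbb Z_{\ge0}^n$ with $\lambda_1\ge\dots\ge\lambda_n$; its length is $\ell(\lambda)=\max\{i:\lambda_i\ne0\}$. $\Lambda(I)$ is the set of partitions $\lambda$ such that $x^\lambda=x_1^{\lambda_1}\cdots x_n^{\lambda_n}$ is a minimal monomial generator of $I$; thus the minimal generators of $I$ are the permutations of the monomials $x^\lambda$, $\lambda\in\Lambda(I)$. Koszul complex: $K^R$ is the Koszul complex of $R$ with respect to $x_1,\dots,x_n$, i.e. the exterior algebra of $R^n$ (basis $e_1,\dots,e_n$) with $\partial(e_i)=\bar x_i$ extended as a derivation; its exterior multiplication induces a product on $H_*(K^R)$. A monomial cycle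 is a cycle of the form $\bar u\,e_{\sigma_1}\wedge\dots\wedge e_{\sigma_p}$, where $\bar u$ is the image in $R$ of a monomial $u\in S$ and $\sigma_1<\dots<\sigma_p$. *)

theory Defs
  imports
    "HOL-Library.Poly_Mapping"
    "HOL-Algebra.QuotRing"
    "HOL-Algebra.Ideal_Product"
    "HOL-Algebra.Divisibility"
    "HOL-Combinatorics.Permutations"
begin

section \<open>The polynomial ring and symmetric monomial ideals\<close>

text \<open>
  An exponent vector is a finitely supported map \<open>m :: nat \<Rightarrow>\<^sub>0 nat\<close>, and a polynomial with
  coefficients in the field \<open>'k\<close> is an element of the convolution ring
  \<open>(nat \<Rightarrow>\<^sub>0 nat) \<Rightarrow>\<^sub>0 'k\<close>, which has variables \<open>x\<^sub>i\<close> for all natural numbers \<open>i\<close>. The ring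
  \<open>k[x\<^sub>1, \<dots>, x\<^sub>n]\<close> consists of the polynomials in which only the indices \<open>1, \<dots>, n\<close> occur.
\<close>

type_synonym 'k mpoly = "(nat \<Rightarrow>\<^sub>0 nat) \<Rightarrow>\<^sub>0 'k"

definition exponents :: "nat \<Rightarrow> (nat \<Rightarrow>\<^sub>0 nat) set" where
  "exponents n = {m. Poly_Mapping.keys m \<subseteq> {1..n}}"

definition mpoly_ring :: "nat \<Rightarrow> ('k::field mpoly) ring" where
  "mpoly_ring n =
     \<lparr>carrier = {f. Poly_Mapping.keys f \<subseteq> exponents n},
      monoid.mult = (*), one = 1, zero = 0, add = (+)\<rparr>"

definition monomial :: "(nat \<Rightarrow>\<^sub>0 nat) \<Rightarrow> 'k::field mpoly" where
  "monomial m = Poly_Mapping.single m 1"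

definition var :: "nat \<Rightarrow> 'k::field mpoly" where
  "var i = monomial (Poly_Mapping.single i 1)"

definition max_ideal :: "nat \<Rightarrow> ('k::field mpoly) set" where
  "max_ideal n = Idl\<^bsub>mpoly_ring n\<^esub> (var ` {1..n})"

definition monomial_ideal :: "nat \<Rightarrow> ('k::field mpoly) set \<Rightarrow> bool" where
  "monomial_ideal n I \<longleftrightarrow> (\<exists>M \<subseteq> exponents n. I = Idl\<^bsub>mpoly_ring n\<^esub> (monomial ` M))"

text \<open>
  The automorphism \<open>x\<^sub>i \<mapsto> x\<^bsub>\<pi> i\<^esub>\<close> sends \<open>x\<^sup>m\<close> to \<open>x\<^sup>m\<^sup>'\<close> with \<open>m' \<circ> \<pi> = m\<close>, so the coefficient
  of \<open>x\<^sup>m\<close> in the image of \<open>f\<close> is the coefficient of \<open>x\<close> to the power \<open>m \<circ> \<pi>\<close> in \<open>f\<close>. The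
  library's \<open>map_key\<close>, which precomposes with an injective map, does this at both levels;
  the definition is meaningful only for bijective \<open>\<pi>\<close>.
\<close>

definition permute_vars :: "(nat \<Rightarrow> nat) \<Rightarrow> 'k::field mpoly \<Rightarrow> 'k mpoly" where
  "permute_vars \<pi> f = Poly_Mapping.map_key (Poly_Mapping.map_key \<pi>) f"

lemma permute_vars_monomial:
  assumes "bij \<pi>"
  shows "permute_vars \<pi> (monomial (Poly_Mapping.map_key \<pi> m)) = monomial m"
proof -
  have "inj (Poly_Mapping.map_key \<pi> :: (nat \<Rightarrow>\<^sub>0 nat) \<Rightarrow> _)"
  proof (rule injI)
    fix a b :: "nat \<Rightarrow>\<^sub>0 nat"
    assume "Poly_Mapping.map_key \<pi> a = Poly_Mapping.map_key \<pi> b"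
    then have "Poly_Mapping.lookup a \<circ> \<pi> = Poly_Mapping.lookup b \<circ> \<pi>"
      using assms by (metis bij_is_inj map_key.rep_eq)
    then have "Poly_Mapping.lookup a = Poly_Mapping.lookup b"
      using assms by (metis bij_is_surj surj_fun_eq)
    then show "a = b" by (simp add: poly_mapping_eqI)
  qed
  then show ?thesis unfolding permute_vars_def monomial_def by simp
qed

lemma permute_vars_var:
  assumes "bij \<pi>"
  shows "permute_vars \<pi> (var i) = var (\<pi> i)"
  using permute_vars_monomial[OF assms, of "Poly_Mapping.single (\<pi> i) 1"] assms
  by (simp add: var_def bij_is_inj)

definition symmetric_monomial_ideal :: "nat \<Rightarrow> ('k::field mpoly) set \<Rightarrow> bool" where
  "symmetric_monomial_ideal n I \<longleftrightarrow>
     monomial_ideal n I \<and> (\<forall>\<pi>. \<pi> permutes {1..n} \<longrightarrow> permute_vars \<pi> ` I \<subseteq> I)"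

section \<open>Generating partitions\<close>

text \<open>A partition \<open>(\<lambda>\<^sub>1, \<dots>, \<lambda>\<^sub>n)\<close> is identified with the exponent vector \<open>i \<mapsto> \<lambda>\<^sub>i\<close>.\<close>

definition exponent_partitions :: "nat \<Rightarrow> (nat \<Rightarrow>\<^sub>0 nat) set" where
  "exponent_partitions n =
     {lam \<in> exponents n. antimono_on {1..n} (Poly_Mapping.lookup lam)}"

abbreviation part :: "(nat \<Rightarrow>\<^sub>0 nat) \<Rightarrow> nat \<Rightarrow> nat" where
  "part lam i \<equiv> Poly_Mapping.lookup lam i"

text \<open>The inserted \<open>0\<close> only matters for the zero partition, whose length is \<open>0\<close>.\<close>

definition part_length :: "(nat \<Rightarrow>\<^sub>0 nat) \<Rightarrow> nat" where
  "part_length lam = Max (insert 0 {i. part lam i \<noteq> 0})"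

definition minimal_generator_exponents :: "nat \<Rightarrow> ('k::field mpoly) set \<Rightarrow> (nat \<Rightarrow>\<^sub>0 nat) set"
  where
  "minimal_generator_exponents n I =
     {m \<in> exponents n. monomial m \<in> I \<and>
        (\<forall>m' \<in> exponents n. monomial m' \<in> I \<and>
            (monomial m' :: 'k mpoly) divides\<^bsub>mpoly_ring n\<^esub> monomial m \<longrightarrow> m' = m)}"

definition generating_partitions :: "nat \<Rightarrow> ('k::field mpoly) set \<Rightarrow> (nat \<Rightarrow>\<^sub>0 nat) set" where
  "generating_partitions n I = exponent_partitions n \<inter> minimal_generator_exponents n I"

section \<open>The Koszul complex of a commutative ring and its homology algebra\<close>

text \<open>
  The exterior algebra of \<open>R\<^sup>n\<close> has as basis the elements
  \<open>e\<^sub>\<sigma> = e\<^bsub>\<sigma>1\<^esub> \<and> \<dots> \<and> e\<^bsub>\<sigma>p\<^esub>\<close> for the subsets \<open>\<sigma> = {\<sigma>1 < \<dots> < \<sigma>p}\<close> of \<open>{1..n}\<close>. An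
  element is represented by its coefficient function \<open>\<sigma> \<mapsto> c \<sigma>\<close>; the homological degree of
  \<open>e\<^sub>\<sigma>\<close> is \<open>card \<sigma>\<close>.
\<close>

definition koszul_carrier :: "('r, 's) ring_scheme \<Rightarrow> nat \<Rightarrow> (nat set \<Rightarrow> 'r) set" where
  "koszul_carrier R n = Pow {1..n} \<rightarrow>\<^sub>E carrier R"

definition basis_chain ::
    "('r, 's) ring_scheme \<Rightarrow> nat \<Rightarrow> 'r \<Rightarrow> nat set \<Rightarrow> (nat set \<Rightarrow> 'r)" where
  "basis_chain R n r \<sigma> = (\<lambda>\<tau> \<in> Pow {1..n}. if \<tau> = \<sigma> then r else \<zero>\<^bsub>R\<^esub>)"

text \<open>
  For disjoint \<open>\<sigma>\<close> and \<open>\<tau>\<close>, \<open>e\<^sub>\<sigma> \<and> e\<^sub>\<tau>\<close> equals \<open>e\<close> indexed by \<open>\<sigma> \<union> \<tau>\<close> up to the sign of the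
  permutation sorting \<open>\<sigma>\<close> followed by \<open>\<tau>\<close>, that is, \<open>-1\<close> to the number of inversions.
\<close>

definition shuffle_sign :: "('r, 's) ring_scheme \<Rightarrow> nat set \<Rightarrow> nat set \<Rightarrow> 'r" where
  "shuffle_sign R \<sigma> \<tau> =
     (\<ominus>\<^bsub>R\<^esub> \<one>\<^bsub>R\<^esub>) [^]\<^bsub>R\<^esub> card {(i, j). i \<in> \<sigma> \<and> j \<in> \<tau> \<and> j < i}"

definition koszul_wedge ::
    "('r, 's) ring_scheme \<Rightarrow> nat \<Rightarrow> (nat set \<Rightarrow> 'r) \<Rightarrow> (nat set \<Rightarrow> 'r) \<Rightarrow> (nat set \<Rightarrow> 'r)" where
  "koszul_wedge R n c d =
     (\<lambda>\<rho> \<in> Pow {1..n}.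
        \<Oplus>\<^bsub>R\<^esub>\<sigma> \<in> Pow \<rho>. shuffle_sign R \<sigma> (\<rho> - \<sigma>) \<otimes>\<^bsub>R\<^esub> (c \<sigma> \<otimes>\<^bsub>R\<^esub> d (\<rho> - \<sigma>)))"

definition koszul_algebra :: "('r, 's) ring_scheme \<Rightarrow> nat \<Rightarrow> (nat set \<Rightarrow> 'r) ring" where
  "koszul_algebra R n =
     \<lparr>carrier = koszul_carrier R n,
      monoid.mult = koszul_wedge R n,
      one = basis_chain R n \<one>\<^bsub>R\<^esub> {},
      zero = (\<lambda>\<sigma> \<in> Pow {1..n}. \<zero>\<^bsub>R\<^esub>),
      add = (\<lambda>c d. \<lambda>\<sigma> \<in> Pow {1..n}. c \<sigma> \<oplus>\<^bsub>R\<^esub> d \<sigma>)\<rparr>"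

text \<open>
  The derivation with \<open>\<partial> e\<^sub>i = x\<^sub>i\<close> is
  \<open>\<partial> (e\<^bsub>\<sigma>1\<^esub> \<and> \<dots> \<and> e\<^bsub>\<sigma>p\<^esub>) = (\<Sum>j = 1..p. (-1)\<^sup>j\<^sup>-\<^sup>1 x\<^bsub>\<sigma>j\<^esub> e\<^bsub>\<sigma> - {\<sigma>j}\<^esub>)\<close>; below this is sorted by the
  basis element \<open>e\<^sub>\<tau>\<close> of the result, with \<open>\<sigma> = insert i \<tau>\<close>.
\<close>

definition koszul_diff ::
    "('r, 's) ring_scheme \<Rightarrow> nat \<Rightarrow> (nat \<Rightarrow> 'r) \<Rightarrow> (nat set \<Rightarrow> 'r) \<Rightarrow> (nat set \<Rightarrow> 'r)" where
  "koszul_diff R n x c =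
     (\<lambda>\<tau> \<in> Pow {1..n}.
        \<Oplus>\<^bsub>R\<^esub>i \<in> {1..n} - \<tau>.
          (\<ominus>\<^bsub>R\<^esub> \<one>\<^bsub>R\<^esub>) [^]\<^bsub>R\<^esub> card {j \<in> \<tau>. j < i} \<otimes>\<^bsub>R\<^esub> (x i \<otimes>\<^bsub>R\<^esub> c (insert i \<tau>)))"

definition koszul_cycles ::
    "('r, 's) ring_scheme \<Rightarrow> nat \<Rightarrow> (nat \<Rightarrow> 'r) \<Rightarrow> (nat set \<Rightarrow> 'r) set" where
  "koszul_cycles R n x =
     {c \<in> koszul_carrier R n. koszul_diff R n x c = \<zero>\<^bsub>koszul_algebra R n\<^esub>}"

definition koszul_boundaries ::
    "('r, 's) ring_scheme \<Rightarrow> nat \<Rightarrow> (nat \<Rightarrow> 'r) \<Rightarrow> (nat set \<Rightarrow> 'r) set" where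
  "koszul_boundaries R n x = koszul_diff R n x ` koszul_carrier R n"

text \<open>The cycles form a subalgebra, in which the boundaries are a two-sided ideal.\<close>

definition koszul_cycle_algebra ::
    "('r, 's) ring_scheme \<Rightarrow> nat \<Rightarrow> (nat \<Rightarrow> 'r) \<Rightarrow> (nat set \<Rightarrow> 'r) ring" where
  "koszul_cycle_algebra R n x = koszul_algebra R n \<lparr>carrier := koszul_cycles R n x\<rparr>"

definition koszul_homology ::
    "('r, 's) ring_scheme \<Rightarrow> nat \<Rightarrow> (nat \<Rightarrow> 'r) \<Rightarrow> (nat set \<Rightarrow> 'r) set ring" where
  "koszul_homology R n x = koszul_cycle_algebra R n x Quot koszul_boundaries R n x"

definition homology_class ::
    "('r, 's) ring_scheme \<Rightarrow> nat \<Rightarrow> (nat \<Rightarrow> 'r) \<Rightarrow> (nat set \<Rightarrow> 'r) \<Rightarrow> (nat set \<Rightarrow> 'r) set"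
  where
  "homology_class R n x z = koszul_boundaries R n x +>\<^bsub>koszul_cycle_algebra R n x\<^esub> z"

section \<open>Monomial cycles over the quotient of the polynomial ring\<close>

definition quotient_ring :: "nat \<Rightarrow> ('k::field mpoly) set \<Rightarrow> ('k mpoly) set ring" where
  "quotient_ring n I = mpoly_ring n Quot I"

definition residue_class :: "nat \<Rightarrow> ('k::field mpoly) set \<Rightarrow> 'k mpoly \<Rightarrow> 'k mpoly set" where
  "residue_class n I f = I +>\<^bsub>mpoly_ring n\<^esub> f"

text \<open>
  The monomial cycles of homological degree at least one, that is, those with \<open>\<sigma> \<noteq> {}\<close>.
\<close>

definition positive_monomial_cycles ::
    "nat \<Rightarrow> ('k::field mpoly) set \<Rightarrow> (nat set \<Rightarrow> 'k mpoly set) set" where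
  "positive_monomial_cycles n I =
     {z. \<exists>m \<in> exponents n. \<exists>\<sigma>. \<sigma> \<subseteq> {1..n} \<and> card \<sigma> \<ge> 1 \<and>
           z = basis_chain (quotient_ring n I) n (residue_class n I (monomial m)) \<sigma> \<and>
           z \<in> koszul_cycles (quotient_ring n I) n (\<lambda>i. residue_class n I (var i))}"

definition monomial_cycle_products_vanish :: "nat \<Rightarrow> ('k::field mpoly) set \<Rightarrow> bool" where
  "monomial_cycle_products_vanish n I \<longleftrightarrow>
     (let R = quotient_ring n I;
          x = (\<lambda>i. residue_class n I (var i));
          H = koszul_homology R n x
      in \<forall>z \<in> positive_monomial_cycles n I. \<forall>w \<in> positive_monomial_cycles n I.
           homology_class R n x z \<otimes>\<^bsub>H\<^esub> homology_class R n x w = \<zero>\<^bsub>H\<^esub>)"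

end

(*
  A product of monomial cycles a e_sigma and b e_tau, with a, b monomials, is +-u e_rho with u = ab
  and rho the disjoint union of sigma and tau. If u lies outside I and u e_rho is not a boundary,
  then exchanging variables by symmetry forces a and b to be boxes: a is the product of the x_i^c
  with i in sigma, and b that of the x_j^c with j in tau, for one and the same c. Otherwise either u
  lies in I, or u e_rho agrees up to sign with the differential of (u / x_l) e_(rho + l) for a
  variable x_l outside rho that divides u. As a x_i lies in I, there is a generating partition with
  first term c + 1, second term at most c and length at most min(|sigma|, |tau|); as u is not in I,
  every partition of length at most p = |rho| has first term at least c + 1. These two facts negate
  (1) and (2) for p. Conversely, such a partition makes the boxes on {1..p div 2} and
  {p div 2 + 1..p} into cycles, and the box u on {1..p} gives no boundary, because no variable
  outside {1..p} divides u.
*)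

theory Submission
  imports Defs
begin

section \<open>Koszul chains over a commutative ring with one\<close>

text \<open>The homology in the statement is a quotient record over another quotient record, a poor
  place for sign computations. Chains over R are therefore represented by chains over the polynomial
  ring, where coefficients live in a type class and vanishing in R reads as membership in I. The
  Leibniz rule makes the boundaries an ideal among the cycles, which reduces a product of cosets to
  one representative.

  Boxes arise from two opposite inequalities. If the product is nonzero, no exponent of b exceeds an
  exponent of a at an index of sigma, since otherwise a transposition would carry a x_i to a divisor
  of ab; likewise no exponent of a exceeds one of b at an index of tau. Hence the exponents of a on
  sigma and of b on tau share one value c, and a further exchange excludes variables outside the two
  sets.

  The halves of p come from p = |sigma| + |tau|: the smaller set has at most p div 2 elements, and
  splitting as evenly as possible attains this. The constant c is one less than the first term of
  the partition, so that a strictly smaller second term is at most c.\<close>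

definition below :: "nat set \<Rightarrow> nat \<Rightarrow> nat" where
  "below \<tau> i = card {j \<in> \<tau>. j < i}"

definition inversions :: "nat set \<Rightarrow> nat set \<Rightarrow> nat" where
  "inversions \<sigma> \<tau> = card {(i, j). i \<in> \<sigma> \<and> j \<in> \<tau> \<and> j < i}"

text \<open>Coefficient functions are total on sets of numbers here. Only their values on subsets of
  {1..n} matter, because \<open>lift_chain\<close> discards all others.\<close>

definition kdiff :: "nat \<Rightarrow> (nat \<Rightarrow> 'r::comm_ring_1) \<Rightarrow> (nat set \<Rightarrow> 'r) \<Rightarrow> nat set \<Rightarrow> 'r" where
  "kdiff n x c \<tau> = (\<Sum>i\<in>{1..n} - \<tau>. (-1) ^ below \<tau> i * (x i * c (insert i \<tau>)))"

definition kwedge :: "(nat set \<Rightarrow> 'r::comm_ring_1) \<Rightarrow> (nat set \<Rightarrow> 'r) \<Rightarrow> nat set \<Rightarrow> 'r" where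
  "kwedge c d \<rho> = (\<Sum>\<sigma>\<in>Pow \<rho>. (-1) ^ inversions \<sigma> (\<rho> - \<sigma>) * (c \<sigma> * d (\<rho> - \<sigma>)))"

text \<open>The grade involution. A chain may mix degrees, so the sign of the Leibniz rule has to be
  attached to each coefficient separately.\<close>

definition kinvol :: "(nat set \<Rightarrow> 'r::comm_ring_1) \<Rightarrow> nat set \<Rightarrow> 'r" where
  "kinvol c \<sigma> = (-1) ^ card \<sigma> * c \<sigma>"

section \<open>Counting inversions for the signs\<close>

lemma below_insert:
  assumes "finite \<tau>" "i \<notin> \<tau>"
  shows "below (insert i \<tau>) j = below \<tau> j + (if i < j then 1 else 0)"
proof (cases "i < j")
  case True
  then have "{k \<in> insert i \<tau>. k < j} = insert i {k \<in> \<tau>. k < j}" by auto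
  then show ?thesis using assms True by (simp add: below_def)
next
  case False
  then have "{k \<in> insert i \<tau>. k < j} = {k \<in> \<tau>. k < j}" by auto
  then show ?thesis using False by (simp add: below_def)
qed

lemma below_Un:
  assumes "finite \<sigma>" "finite \<tau>" "\<sigma> \<inter> \<tau> = {}"
  shows "below (\<sigma> \<union> \<tau>) j = below \<sigma> j + below \<tau> j"
proof -
  have "{k \<in> \<sigma> \<union> \<tau>. k < j} = {k \<in> \<sigma>. k < j} \<union> {k \<in> \<tau>. k < j}" by auto
  then show ?thesis unfolding below_def using assms by (simp add: card_Un_disjoint disjoint_iff)
qed

lemma finite_inversions:
  assumes "finite \<sigma>" "finite \<tau>"
  shows "finite {(i, j). i \<in> \<sigma> \<and> j \<in> \<tau> \<and> (j::nat) < i}"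
  by (rule finite_subset[of _ "\<sigma> \<times> \<tau>"]) (use assms in auto)

lemma inversions_insert_left:
  assumes "finite \<sigma>" "finite \<tau>" "i \<notin> \<sigma>"
  shows "inversions (insert i \<sigma>) \<tau> = inversions \<sigma> \<tau> + below \<tau> i"
proof -
  have "{(a, b). a \<in> insert i \<sigma> \<and> b \<in> \<tau> \<and> b < a} =
      {(a, b). a \<in> \<sigma> \<and> b \<in> \<tau> \<and> b < a} \<union> Pair i ` {j \<in> \<tau>. j < i}" by auto
  moreover have "card (Pair i ` {j \<in> \<tau>. j < i}) = below \<tau> i"
    unfolding below_def by (rule card_image) (simp add: inj_on_def)
  moreover have "{(a, b). a \<in> \<sigma> \<and> b \<in> \<tau> \<and> b < a} \<inter> Pair i ` {j \<in> \<tau>. j < i} = {}"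
    using assms by auto
  ultimately show ?thesis
    unfolding inversions_def using assms
    by (simp add: card_Un_disjoint finite_inversions)
qed

text \<open>A new right-hand element i is inverted with the elements of \<open>\<sigma>\<close>
  above it, which number \<open>card \<sigma>\<close> minus \<open>below \<sigma> i\<close>. Adding
  \<open>below\<close> on the left avoids natural subtraction and suits the parity
  arguments.\<close>

lemma inversions_insert_right:
  assumes "finite \<sigma>" "finite \<tau>" "i \<notin> \<tau>" "i \<notin> \<sigma>"
  shows "inversions \<sigma> (insert i \<tau>) + below \<sigma> i = inversions \<sigma> \<tau> + card \<sigma>"
proof -
  have "{(a, b). a \<in> \<sigma> \<and> b \<in> insert i \<tau> \<and> b < a} =
      {(a, b). a \<in> \<sigma> \<and> b \<in> \<tau> \<and> b < a} \<union> (\<lambda>j. (j, i)) ` {j \<in> \<sigma>. i < j}" by auto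
  moreover have "card ((\<lambda>j. (j, i)) ` {j \<in> \<sigma>. i < j}) = card {j \<in> \<sigma>. i < j}"
    by (rule card_image) (simp add: inj_on_def)
  moreover have "{(a, b). a \<in> \<sigma> \<and> b \<in> \<tau> \<and> b < a} \<inter> (\<lambda>j. (j, i)) ` {j \<in> \<sigma>. i < j} = {}"
    using assms by auto
  ultimately have 1: "inversions \<sigma> (insert i \<tau>) = inversions \<sigma> \<tau> + card {j \<in> \<sigma>. i < j}"
    unfolding inversions_def using assms
    by (simp add: card_Un_disjoint finite_inversions)
  have "\<sigma> = {j \<in> \<sigma>. i < j} \<union> {j \<in> \<sigma>. j < i}"
    using assms by (auto intro: linorder_cases)
  then have "card \<sigma> = card {j \<in> \<sigma>. i < j} + card {j \<in> \<sigma>. j < i}"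
    using assms(1) by (metis (no_types, lifting) card_Un_disjoint disjoint_iff finite_Un
        mem_Collect_eq not_less_iff_gr_or_eq)
  with 1 show ?thesis by (simp add: below_def)
qed

text \<open>The double sum runs over ordered pairs of distinct indices. Swapping a pair flips the
  sign, because the index inserted earlier is counted by \<open>below\<close> for the later one
  exactly when it is the smaller of the two.\<close>

lemma kdiff_kdiff:
  fixes x :: "nat \<Rightarrow> 'r::comm_ring_1"
  assumes "finite \<tau>"
  shows "kdiff n x (kdiff n x c) \<tau> = 0"
proof -
  define f where "f = (\<lambda>(i, j). (-1) ^ below \<tau> i * (-1) ^ below (insert i \<tau>) j *
    (x i * x j * c (insert j (insert i \<tau>))))"
  define P where "P = (SIGMA i:{1..n} - \<tau>. {1..n} - insert i \<tau>)"
  define P1 where "P1 = {(i, j) \<in> P. i < j}"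
  define P2 where "P2 = {(i, j) \<in> P. j < i}"
  have fin: "finite P" by (simp add: P_def)
  have fin12: "finite P1" "finite P2"
    by (rule finite_subset[OF _ fin], auto simp: P1_def P2_def)+
  have "kdiff n x (kdiff n x c) \<tau> = (\<Sum>p\<in>P. f p)"
    unfolding kdiff_def P_def f_def
    by (subst sum.Sigma[symmetric]) (auto simp: sum_distrib_left algebra_simps intro!: sum.cong)
  also have "P = P1 \<union> P2"
    by (auto simp: P_def P1_def P2_def)
  also have "(\<Sum>p\<in>P1 \<union> P2. f p) = (\<Sum>p\<in>P1. f p) + (\<Sum>p\<in>P2. f p)"
    by (rule sum.union_disjoint) (use fin12 in \<open>auto simp: P1_def P2_def\<close>)
  also have "(\<Sum>p\<in>P2. f p) = (\<Sum>p\<in>P1. - f p)"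
  proof (rule sum.reindex_bij_witness[of _ "\<lambda>(i, j). (j, i)" "\<lambda>(i, j). (j, i)"])
    fix p assume "p \<in> P2"
    then obtain i j where p: "p = (i, j)" "i \<notin> \<tau>" "j \<notin> \<tau>" "j < i"
      by (auto simp: P2_def P_def)
    then show "- f (case p of (i, j) \<Rightarrow> (j, i)) = f p"
      using assms by (simp add: f_def below_insert insert_commute[of j] algebra_simps)
  qed (auto simp: P1_def P2_def P_def)
  finally show ?thesis by (simp add: sum_negf)
qed

lemma sum_Pow_insert:
  assumes "finite \<rho>" "i \<notin> \<rho>"
  shows "sum f (Pow (insert i \<rho>)) = (\<Sum>\<sigma>\<in>Pow \<rho>. f \<sigma> + (f (insert i \<sigma>) :: 'r::comm_monoid_add))"
proof -
  have "inj_on (insert i) (Pow \<rho>)"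
    using assms(2) by (intro inj_onI) (auto simp: insert_ident)
  moreover have "Pow \<rho> \<inter> insert i ` Pow \<rho> = {}" using assms(2) by auto
  ultimately show ?thesis
    using assms by (simp add: Pow_insert sum.union_disjoint sum.reindex sum.distrib)
qed

lemma minus_one_power_cong:
  "even (a + b) \<Longrightarrow> (-1) ^ a = ((-1) ^ b :: 'r::comm_ring_1)"
  by (simp add: minus_one_power_iff)

lemma minus_one_power_cong_neg:
  "odd (a + b) \<Longrightarrow> (-1) ^ a = - ((-1) ^ b :: 'r::comm_ring_1)"
  by (auto simp: minus_one_power_iff)

text \<open>The Leibniz rule. An index i outside \<open>\<rho>\<close> joins either
  \<open>\<sigma>\<close> or its complement in \<open>\<rho>\<close>, and these terms match on both
  sides. The right-hand side also has terms with i in \<open>\<rho>\<close>, where i occurs in both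
  factors; they have no counterpart on the left and must cancel.\<close>

lemma kdiff_kwedge:
  fixes x :: "nat \<Rightarrow> 'r::comm_ring_1"
  assumes \<rho>: "\<rho> \<subseteq> {1..n}"
  shows "kdiff n x (kwedge c d) \<rho> = kwedge (kdiff n x c) d \<rho> + kwedge (kinvol c) (kdiff n x d) \<rho>"
proof -
  let ?N = "{1..n} - \<rho>"
  have fin: "finite \<rho>" using \<rho> finite_subset by blast
  have finS: "finite \<sigma>" "finite (\<rho> - \<sigma>)" if "\<sigma> \<in> Pow \<rho>" for \<sigma>
    using that fin finite_subset by auto
  \<comment> \<open>The terms \<open>T1\<close> and \<open>T2\<close> occur on both sides; the other terms \<open>U\<close> and \<open>V\<close> of the right-hand
    side cancel under \<open>(\<sigma>, i) \<mapsto> (insert i \<sigma>, i)\<close>.\<close>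
  define T1 where "T1 = (\<lambda>\<sigma> i. (-1) ^ (below \<rho> i + inversions \<sigma> (insert i (\<rho> - \<sigma>))) *
    (x i * (c \<sigma> * d (insert i (\<rho> - \<sigma>)))))"
  define T2 where "T2 = (\<lambda>\<sigma> i. (-1) ^ (below \<rho> i + inversions (insert i \<sigma>) (\<rho> - \<sigma>)) *
    (x i * (c (insert i \<sigma>) * d (\<rho> - \<sigma>))))"
  define U where "U = (\<lambda>\<sigma> i. (-1) ^ (inversions \<sigma> (\<rho> - \<sigma>) + below \<sigma> i) *
    (x i * (c (insert i \<sigma>) * d (\<rho> - \<sigma>))))"
  define V where "V = (\<lambda>\<sigma> i. (-1) ^ (card \<sigma> + inversions \<sigma> (\<rho> - \<sigma>) + below (\<rho> - \<sigma>) i) *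
    (x i * (c \<sigma> * d (insert i (\<rho> - \<sigma>)))))"
  have "kdiff n x (kwedge c d) \<rho> = (\<Sum>i\<in>?N. \<Sum>\<sigma>\<in>Pow \<rho>. T1 \<sigma> i + T2 \<sigma> i)"
    unfolding kdiff_def
  proof (rule sum.cong[OF refl])
    fix i assume i: "i \<in> ?N"
    then have eq: "insert i \<rho> - \<sigma> = insert i (\<rho> - \<sigma>)" "insert i \<rho> - insert i \<sigma> = \<rho> - \<sigma>"
      if "\<sigma> \<in> Pow \<rho>" for \<sigma> using that by auto
    have "kwedge c d (insert i \<rho>) = (\<Sum>\<sigma>\<in>Pow \<rho>.
        (-1) ^ inversions \<sigma> (insert i (\<rho> - \<sigma>)) * (c \<sigma> * d (insert i (\<rho> - \<sigma>))) +
        (-1) ^ inversions (insert i \<sigma>) (\<rho> - \<sigma>) * (c (insert i \<sigma>) * d (\<rho> - \<sigma>)))"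
      unfolding kwedge_def using i fin by (subst sum_Pow_insert) (auto simp: eq intro!: sum.cong)
    then show "(-1) ^ below \<rho> i * (x i * kwedge c d (insert i \<rho>)) =
        (\<Sum>\<sigma>\<in>Pow \<rho>. T1 \<sigma> i + T2 \<sigma> i)"
      unfolding T1_def T2_def
      by (simp add: sum_distrib_left power_add algebra_simps)
  qed
  also have "\<dots> = (\<Sum>\<sigma>\<in>Pow \<rho>. \<Sum>i\<in>?N. T2 \<sigma> i) + (\<Sum>\<sigma>\<in>Pow \<rho>. \<Sum>i\<in>?N. T1 \<sigma> i)"
    by (subst sum.swap) (simp add: sum.distrib add.commute)
  finally have lhs: "kdiff n x (kwedge c d) \<rho> = \<dots>" .
  have "kwedge (kdiff n x c) d \<rho> = (\<Sum>\<sigma>\<in>Pow \<rho>. (\<Sum>i\<in>?N. T2 \<sigma> i) + (\<Sum>i\<in>\<rho> - \<sigma>. U \<sigma> i))"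
    unfolding kwedge_def
  proof (rule sum.cong[OF refl])
    fix \<sigma> assume \<sigma>: "\<sigma> \<in> Pow \<rho>"
    have "(-1) ^ inversions \<sigma> (\<rho> - \<sigma>) * (kdiff n x c \<sigma> * d (\<rho> - \<sigma>)) = (\<Sum>i\<in>{1..n} - \<sigma>. U \<sigma> i)"
      unfolding kdiff_def U_def sum_distrib_left sum_distrib_right
      by (simp add: power_add algebra_simps)
    also have "{1..n} - \<sigma> = ?N \<union> (\<rho> - \<sigma>)" using \<sigma> \<rho> by auto
    also have "(\<Sum>i\<in>?N \<union> (\<rho> - \<sigma>). U \<sigma> i) = (\<Sum>i\<in>?N. U \<sigma> i) + (\<Sum>i\<in>\<rho> - \<sigma>. U \<sigma> i)"
      by (rule sum.union_disjoint) (use fin in auto)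
    also have "(\<Sum>i\<in>?N. U \<sigma> i) = (\<Sum>i\<in>?N. T2 \<sigma> i)"
    proof (rule sum.cong[OF refl])
      fix i assume i: "i \<in> ?N"
      have "below \<rho> i = below \<sigma> i + below (\<rho> - \<sigma>) i"
        using below_Un[of \<sigma> "\<rho> - \<sigma>" i] finS[OF \<sigma>] \<sigma> by (simp add: Un_absorb1)
      moreover have "inversions (insert i \<sigma>) (\<rho> - \<sigma>) = inversions \<sigma> (\<rho> - \<sigma>) + below (\<rho> - \<sigma>) i"
        using inversions_insert_left[of \<sigma> "\<rho> - \<sigma>" i] finS[OF \<sigma>] \<sigma> i by auto
      ultimately have "even (inversions \<sigma> (\<rho> - \<sigma>) + below \<sigma> i +
          (below \<rho> i + inversions (insert i \<sigma>) (\<rho> - \<sigma>)))"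
        by presburger
      then show "U \<sigma> i = T2 \<sigma> i"
        unfolding U_def T2_def
        by (intro arg_cong2[of _ _ _ _ "(*)"] minus_one_power_cong refl)
    qed
    finally show "(-1) ^ inversions \<sigma> (\<rho> - \<sigma>) * (kdiff n x c \<sigma> * d (\<rho> - \<sigma>)) =
      (\<Sum>i\<in>?N. T2 \<sigma> i) + (\<Sum>i\<in>\<rho> - \<sigma>. U \<sigma> i)" .
  qed
  also have "\<dots> = (\<Sum>\<sigma>\<in>Pow \<rho>. \<Sum>i\<in>?N. T2 \<sigma> i) + (\<Sum>\<sigma>\<in>Pow \<rho>. \<Sum>i\<in>\<rho> - \<sigma>. U \<sigma> i)"
    by (rule sum.distrib)
  finally have r1: "kwedge (kdiff n x c) d \<rho> = \<dots>" .
  have "kwedge (kinvol c) (kdiff n x d) \<rho> = (\<Sum>\<sigma>\<in>Pow \<rho>. (\<Sum>i\<in>?N. T1 \<sigma> i) + (\<Sum>i\<in>\<sigma>. V \<sigma> i))"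
    unfolding kwedge_def
  proof (rule sum.cong[OF refl])
    fix \<sigma> assume \<sigma>: "\<sigma> \<in> Pow \<rho>"
    have "(-1) ^ inversions \<sigma> (\<rho> - \<sigma>) * (kinvol c \<sigma> * kdiff n x d (\<rho> - \<sigma>)) =
        (\<Sum>i\<in>{1..n} - (\<rho> - \<sigma>). V \<sigma> i)"
      unfolding kdiff_def V_def sum_distrib_left sum_distrib_right kinvol_def
      by (simp add: power_add algebra_simps)
    also have "{1..n} - (\<rho> - \<sigma>) = ?N \<union> \<sigma>" using \<sigma> \<rho> by auto
    also have "(\<Sum>i\<in>?N \<union> \<sigma>. V \<sigma> i) = (\<Sum>i\<in>?N. V \<sigma> i) + (\<Sum>i\<in>\<sigma>. V \<sigma> i)"
      by (rule sum.union_disjoint) (use finS[OF \<sigma>] \<sigma> in auto)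
    also have "(\<Sum>i\<in>?N. V \<sigma> i) = (\<Sum>i\<in>?N. T1 \<sigma> i)"
    proof (rule sum.cong[OF refl])
      fix i assume i: "i \<in> ?N"
      have "below \<rho> i = below \<sigma> i + below (\<rho> - \<sigma>) i"
        using below_Un[of \<sigma> "\<rho> - \<sigma>" i] finS[OF \<sigma>] \<sigma> by (simp add: Un_absorb1)
      moreover have "inversions \<sigma> (insert i (\<rho> - \<sigma>)) + below \<sigma> i = inversions \<sigma> (\<rho> - \<sigma>) + card \<sigma>"
        using inversions_insert_right[of \<sigma> "\<rho> - \<sigma>" i] finS[OF \<sigma>] \<sigma> i by auto
      ultimately have "even (card \<sigma> + inversions \<sigma> (\<rho> - \<sigma>) + below (\<rho> - \<sigma>) i +
          (below \<rho> i + inversions \<sigma> (insert i (\<rho> - \<sigma>))))"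
        by presburger
      then show "V \<sigma> i = T1 \<sigma> i"
        unfolding V_def T1_def
        by (intro arg_cong2[of _ _ _ _ "(*)"] minus_one_power_cong refl)
    qed
    finally show "(-1) ^ inversions \<sigma> (\<rho> - \<sigma>) * (kinvol c \<sigma> * kdiff n x d (\<rho> - \<sigma>)) =
      (\<Sum>i\<in>?N. T1 \<sigma> i) + (\<Sum>i\<in>\<sigma>. V \<sigma> i)" .
  qed
  also have "\<dots> = (\<Sum>\<sigma>\<in>Pow \<rho>. \<Sum>i\<in>?N. T1 \<sigma> i) + (\<Sum>\<sigma>\<in>Pow \<rho>. \<Sum>i\<in>\<sigma>. V \<sigma> i)"
    by (rule sum.distrib)
  finally have r2: "kwedge (kinvol c) (kdiff n x d) \<rho> = \<dots>" .
  have "(\<Sum>\<sigma>\<in>Pow \<rho>. \<Sum>i\<in>\<sigma>. V \<sigma> i) = (\<Sum>(\<sigma>, i)\<in>(SIGMA \<sigma>:Pow \<rho>. \<sigma>). V \<sigma> i)"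
    by (rule sum.Sigma) (use fin finS in auto)
  also have "\<dots> = (\<Sum>(\<sigma>, i)\<in>(SIGMA \<sigma>:Pow \<rho>. \<rho> - \<sigma>). - U \<sigma> i)"
  proof (rule sum.reindex_bij_witness[of _ "\<lambda>(\<sigma>, i). (insert i \<sigma>, i)" "\<lambda>(\<sigma>, i). (\<sigma> - {i}, i)"])
    fix p assume "p \<in> (SIGMA \<sigma>:Pow \<rho>. \<sigma>)"
    then obtain \<sigma>' i where p': "p = (\<sigma>', i)" "\<sigma>' \<in> Pow \<rho>" "i \<in> \<sigma>'" by auto
    define \<sigma> where "\<sigma> = \<sigma>' - {i}"
    define \<tau> where "\<tau> = \<rho> - \<sigma>'"
    have p: "p = (insert i \<sigma>, i)" "\<sigma> \<in> Pow \<rho>" "i \<notin> \<sigma>" "i \<in> \<rho>" "i \<notin> \<tau>"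
      "\<rho> - \<sigma> = insert i \<tau>" "\<rho> - insert i \<sigma> = \<tau>"
      using p' by (auto simp: \<sigma>_def \<tau>_def)
    have fst: "finite \<sigma>" "finite \<tau>" using fin p(2) finite_subset by (auto simp: \<tau>_def)
    have i1: "inversions (insert i \<sigma>) \<tau> = inversions \<sigma> \<tau> + below \<tau> i"
      by (rule inversions_insert_left) (use fst p in auto)
    have i2: "inversions \<sigma> (insert i \<tau>) + below \<sigma> i = inversions \<sigma> \<tau> + card \<sigma>"
      by (rule inversions_insert_right) (use fst p in auto)
    have "card (insert i \<sigma>) = Suc (card \<sigma>)" using fst p by simp
    \<comment> \<open>After substituting \<open>i1\<close> and \<open>i2\<close> every quantity
      occurs twice, except for the one element that \<open>insert i \<sigma>\<close> has more than
      \<open>\<sigma>\<close>.\<close>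
    with i1 i2 have "odd (card (insert i \<sigma>) + inversions (insert i \<sigma>) \<tau> + below \<tau> i +
        (inversions \<sigma> (insert i \<tau>) + below \<sigma> i))" by presburger
    then have "V (insert i \<sigma>) i = - U \<sigma> i"
      unfolding V_def U_def p(6,7) mult_minus_left[symmetric]
      by (intro arg_cong2[of _ _ _ _ "(*)"] minus_one_power_cong_neg refl)
    then show "(case case p of (\<sigma>, i) \<Rightarrow> (\<sigma> - {i}, i) of (\<sigma>, i) \<Rightarrow> - U \<sigma> i) =
        (case p of (\<sigma>, i) \<Rightarrow> V \<sigma> i)"
      using p by simp
  qed auto
  also have "\<dots> = (\<Sum>\<sigma>\<in>Pow \<rho>. \<Sum>i\<in>\<rho> - \<sigma>. - U \<sigma> i)"
    by (rule sum.Sigma[symmetric]) (use fin finS in auto)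
  finally show ?thesis
    unfolding lhs r1 r2 by (simp add: sum_negf)
qed

section \<open>Koszul chains over a quotient of the polynomial ring\<close>

lemma zero_in_exponents [simp]: "0 \<in> exponents n"
  by (simp add: exponents_def)

lemma exponents_add: "a \<in> exponents n \<Longrightarrow> b \<in> exponents n \<Longrightarrow> a + b \<in> exponents n"
  unfolding exponents_def using keys_add[of a b] by blast

lemma exponents_minus: "a \<in> exponents n \<Longrightarrow> a - b \<in> exponents n"
proof -
  have "Poly_Mapping.keys (a - b) \<subseteq> Poly_Mapping.keys a"
    by (auto simp: in_keys_iff lookup_minus)
  then show "a \<in> exponents n \<Longrightarrow> a - b \<in> exponents n"
    unfolding exponents_def by blast
qed

lemma exponents_single: "i \<in> {1..n} \<Longrightarrow> Poly_Mapping.single i k \<in> exponents n"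
  by (simp add: exponents_def)

lemma mpoly_ring_simps [simp]:
  "f \<otimes>\<^bsub>mpoly_ring n\<^esub> g = f * g" "f \<oplus>\<^bsub>mpoly_ring n\<^esub> g = f + g"
  "\<one>\<^bsub>mpoly_ring n\<^esub> = 1" "\<zero>\<^bsub>mpoly_ring n\<^esub> = 0"
  by (simp_all add: mpoly_ring_def)

lemma carrier_mpoly_ring: "f \<in> carrier (mpoly_ring n) \<longleftrightarrow> Poly_Mapping.keys f \<subseteq> exponents n"
  by (simp add: mpoly_ring_def)

lemma mpoly_ring_closed [simp]:
  fixes f g :: "'k::field mpoly"
  assumes "f \<in> carrier (mpoly_ring n)"
  shows "- f \<in> carrier (mpoly_ring n)"
    and "g \<in> carrier (mpoly_ring n) \<Longrightarrow> f + g \<in> carrier (mpoly_ring n)"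
    and "g \<in> carrier (mpoly_ring n) \<Longrightarrow> f * g \<in> carrier (mpoly_ring n)"
    and "g \<in> carrier (mpoly_ring n) \<Longrightarrow> f - g \<in> carrier (mpoly_ring n)"
proof -
  show "- f \<in> carrier (mpoly_ring n)"
    using assms unfolding carrier_mpoly_ring by (auto simp: in_keys_iff)
  assume g: "g \<in> carrier (mpoly_ring n)"
  show "f + g \<in> carrier (mpoly_ring n)"
    using assms g keys_add[of f g] unfolding carrier_mpoly_ring by blast
  show "f * g \<in> carrier (mpoly_ring n)"
    using assms g keys_mult[of f g] unfolding carrier_mpoly_ring by (blast intro: exponents_add)
  have "f + - g \<in> carrier (mpoly_ring n)"
    using assms g keys_add[of f "- g"] unfolding carrier_mpoly_ring by (auto simp: in_keys_iff subset_iff)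
  then show "f - g \<in> carrier (mpoly_ring n)" by simp
qed

lemma mpoly_ring_one_zero [simp]:
  "(1 :: 'k::field mpoly) \<in> carrier (mpoly_ring n)" "(0 :: 'k::field mpoly) \<in> carrier (mpoly_ring n)"
  by (auto simp: carrier_mpoly_ring)

lemma mpoly_ring_sign [simp]: "(-1) ^ k \<in> carrier (mpoly_ring n :: ('k::field mpoly) ring)"
  by (induction k) simp_all

lemma mpoly_ring_sum:
  "(\<And>a. a \<in> A \<Longrightarrow> f a \<in> carrier (mpoly_ring n)) \<Longrightarrow>
    sum f A \<in> carrier (mpoly_ring n :: ('k::field mpoly) ring)"
  by (induction A rule: infinite_finite_induct) simp_all

lemma monomial_in_mpoly_ring [simp]:
  "(monomial m :: 'k::field mpoly) \<in> carrier (mpoly_ring n) \<longleftrightarrow> m \<in> exponents n"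
  by (simp add: carrier_mpoly_ring monomial_def)

lemma var_in_mpoly_ring [simp]:
  "i \<in> {1..n} \<Longrightarrow> (var i :: 'k::field mpoly) \<in> carrier (mpoly_ring n)"
  by (simp add: var_def exponents_single)

lemma monomial_add: "(monomial (a + b) :: 'k::field mpoly) = monomial a * monomial b"
  by (simp add: monomial_def mult_single)

lemma cring_mpoly_ring: "cring (mpoly_ring n :: ('k::field mpoly) ring)"
proof (rule cringI)
  show "abelian_group (mpoly_ring n :: ('k mpoly) ring)"
  proof (rule abelian_groupI)
    fix f :: "'k mpoly" assume "f \<in> carrier (mpoly_ring n)"
    then show "\<exists>g\<in>carrier (mpoly_ring n). g \<oplus>\<^bsub>mpoly_ring n\<^esub> f = \<zero>\<^bsub>mpoly_ring n\<^esub>"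
      by (intro bexI[of _ "- f"]) simp_all
  qed (simp_all add: add.assoc add.commute)
  show "Group.comm_monoid (mpoly_ring n :: ('k mpoly) ring)"
    by (rule comm_monoidI) (simp_all add: ac_simps)
qed (simp add: distrib_right)

lemma a_inv_mpoly_ring [simp]:
  fixes f :: "'k::field mpoly"
  assumes "f \<in> carrier (mpoly_ring n)"
  shows "\<ominus>\<^bsub>mpoly_ring n\<^esub> f = - f"
proof -
  interpret cring "mpoly_ring n :: ('k mpoly) ring" by (rule cring_mpoly_ring)
  show ?thesis
    by (rule minus_equality) (use assms in simp_all)
qed

text \<open>Carries the ideal property alone, on which the passage from homology classes to chains
  rests; monomiality and symmetry enter with \<open>symmetric_quotient\<close>.\<close>

locale mpoly_quotient =
  fixes n :: nat and I :: "('k::field mpoly) set"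
  assumes ideal_I: "ideal I (mpoly_ring n)"
begin

abbreviation S :: "('k mpoly) ring" where "S \<equiv> mpoly_ring n"
abbreviation R :: "('k mpoly) set ring" where "R \<equiv> quotient_ring n I"
abbreviation proj :: "'k mpoly \<Rightarrow> 'k mpoly set" where "proj \<equiv> residue_class n I"
abbreviation X :: "nat \<Rightarrow> 'k mpoly set" where "X \<equiv> \<lambda>i. proj (var i)"

lemma proj_eq: "proj = (+>\<^bsub>S\<^esub>) I"
  by (simp add: residue_class_def fun_eq_iff)

sublocale I: ideal I S by (rule ideal_I)

sublocale proj: ring_hom_cring S R proj
  unfolding proj_eq quotient_ring_def by (rule I.rcos_ring_hom_cring[OF cring_mpoly_ring])

lemma proj_eq_iff:
  assumes "f \<in> carrier S" "g \<in> carrier S"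
  shows "proj f = proj g \<longleftrightarrow> f - g \<in> I"
proof -
  have "f - g = f \<ominus>\<^bsub>S\<^esub> g"
    using assms by (simp add: a_minus_def)
  then show ?thesis
    unfolding proj_eq using I.quotient_eq_iff_same_a_r_cos[OF ideal_I assms] by auto
qed

lemma I_closed:
  "f \<in> I \<Longrightarrow> g \<in> I \<Longrightarrow> f + g \<in> I" "0 \<in> I"
  "f \<in> I \<Longrightarrow> g \<in> carrier S \<Longrightarrow> g * f \<in> I"
  "f \<in> I \<Longrightarrow> g \<in> carrier S \<Longrightarrow> f * g \<in> I"
  "f \<in> I \<Longrightarrow> - f \<in> I"
  "f \<in> I \<Longrightarrow> g \<in> I \<Longrightarrow> f - g \<in> I"
proof -
  show add: "f \<in> I \<Longrightarrow> g \<in> I \<Longrightarrow> f + g \<in> I" for f g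
    using additive_subgroup.a_closed[OF I.additive_subgroup_axioms, of f g] by simp
  show "0 \<in> I" using additive_subgroup.zero_closed[OF I.additive_subgroup_axioms] by simp
  show l: "f \<in> I \<Longrightarrow> g \<in> carrier S \<Longrightarrow> g * f \<in> I" for f g
    using I.I_l_closed[of f g] by simp
  show "f \<in> I \<Longrightarrow> g \<in> carrier S \<Longrightarrow> f * g \<in> I"
    using I.I_r_closed[of f g] by simp
  show neg: "f \<in> I \<Longrightarrow> - f \<in> I" for f
    using l[of f "- 1"] by simp
  show "f \<in> I \<Longrightarrow> g \<in> I \<Longrightarrow> f - g \<in> I"
    using add[of f "- g"] neg by simp
qed

lemma I_sum: "(\<And>a. a \<in> A \<Longrightarrow> f a \<in> I) \<Longrightarrow> sum f A \<in> I"
  by (induction A rule: infinite_finite_induct) (simp_all add: I_closed)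

lemma proj_add: "f \<in> carrier S \<Longrightarrow> g \<in> carrier S \<Longrightarrow> proj (f + g) = proj f \<oplus>\<^bsub>R\<^esub> proj g"
  using proj.hom_add by simp

lemma proj_mult: "f \<in> carrier S \<Longrightarrow> g \<in> carrier S \<Longrightarrow> proj (f * g) = proj f \<otimes>\<^bsub>R\<^esub> proj g"
  using proj.hom_mult by simp

lemma proj_zero: "proj 0 = \<zero>\<^bsub>R\<^esub>"
  using proj.hom_zero by simp

lemma proj_sum:
  "(\<And>a. a \<in> A \<Longrightarrow> f a \<in> carrier S) \<Longrightarrow> proj (sum f A) = (\<Oplus>\<^bsub>R\<^esub>a\<in>A. proj (f a))"
proof (induction A rule: infinite_finite_induct)
  case (insert a A)
  then have "proj (sum f (insert a A)) = proj (f a) \<oplus>\<^bsub>R\<^esub> proj (sum f A)"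
    by (simp add: proj_add mpoly_ring_sum)
  then show ?case
    using insert by (subst proj.S.finsum_insert) auto
qed (simp_all add: proj_zero)

lemma sign_eq_proj: "(\<ominus>\<^bsub>R\<^esub> \<one>\<^bsub>R\<^esub>) [^]\<^bsub>R\<^esub> (k::nat) = proj ((-1) ^ k)"
proof -
  have 1: "\<ominus>\<^bsub>R\<^esub> \<one>\<^bsub>R\<^esub> = proj (- 1)"
    using proj.hom_a_inv[of 1] proj.hom_one by simp
  show ?thesis
    unfolding 1
  proof (induction k)
    case (Suc k)
    then show ?case
      using proj_mult[OF mpoly_ring_sign[of k] mpoly_ring_sign[of 1]] by simp
  qed (use proj.hom_one in simp)
qed

text \<open>
  Chains over \<open>R\<close> are handled through their lifts to the polynomial ring, where the identities
  for \<^const>\<open>kdiff\<close> and \<^const>\<open>kwedge\<close> hold in a type class.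
\<close>

definition lift_chain :: "(nat set \<Rightarrow> 'k mpoly) \<Rightarrow> nat set \<Rightarrow> 'k mpoly set" where
  "lift_chain c = (\<lambda>\<sigma>\<in>Pow {1..n}. proj (c \<sigma>))"

definition chains :: "(nat set \<Rightarrow> 'k mpoly) set" where
  "chains = {c. \<forall>\<sigma>\<subseteq>{1..n}. c \<sigma> \<in> carrier S}"

definition cycles :: "(nat set \<Rightarrow> 'k mpoly) set" where
  "cycles = {c \<in> chains. \<forall>\<tau>\<subseteq>{1..n}. kdiff n var c \<tau> \<in> I}"

text \<open>The preimage of the Koszul boundaries under \<open>lift_chain\<close>: congruence modulo
  I replaces equality, so every chain with coefficients in I belongs to it.\<close>

definition boundaries :: "(nat set \<Rightarrow> 'k mpoly) set" where
  "boundaries = {c \<in> chains. \<exists>d\<in>chains. \<forall>\<tau>\<subseteq>{1..n}. c \<tau> - kdiff n var d \<tau> \<in> I}"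

lemma chainsD: "c \<in> chains \<Longrightarrow> \<sigma> \<subseteq> {1..n} \<Longrightarrow> c \<sigma> \<in> carrier S"
  by (simp add: chains_def)

lemma kdiff_chains: "c \<in> chains \<Longrightarrow> kdiff n var c \<in> chains"
  by (subst chains_def) (auto simp: kdiff_def intro!: mpoly_ring_sum mpoly_ring_closed chainsD[of c])

lemma kwedge_chains: "c \<in> chains \<Longrightarrow> d \<in> chains \<Longrightarrow> kwedge c d \<in> chains"
  by (subst chains_def)
    (auto simp: kwedge_def intro!: mpoly_ring_sum mpoly_ring_closed chainsD[of c] chainsD[of d])

lemma kinvol_chains: "c \<in> chains \<Longrightarrow> kinvol c \<in> chains"
  unfolding chains_def kinvol_def by auto

lemma add_chains: "c \<in> chains \<Longrightarrow> d \<in> chains \<Longrightarrow> (\<lambda>\<sigma>. c \<sigma> + d \<sigma>) \<in> chains"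
  unfolding chains_def by auto

lemma lift_chain_eq_iff:
  assumes "c \<in> chains" "d \<in> chains"
  shows "lift_chain c = lift_chain d \<longleftrightarrow> (\<forall>\<sigma>\<subseteq>{1..n}. c \<sigma> - d \<sigma> \<in> I)"
proof -
  have "lift_chain c = lift_chain d \<longleftrightarrow> (\<forall>\<sigma>\<subseteq>{1..n}. proj (c \<sigma>) = proj (d \<sigma>))"
    by (auto simp: lift_chain_def fun_eq_iff restrict_def)
  then show ?thesis
    using assms by (auto simp: chains_def proj_eq_iff)
qed

lemma lift_chain_in_carrier: "c \<in> chains \<Longrightarrow> lift_chain c \<in> koszul_carrier R n"
  unfolding lift_chain_def koszul_carrier_def chains_def by auto

text \<open>Choosing a representative of each coefficient shows that lifting is surjective, so
  quantification over chains over R can be replaced by quantification over polynomial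
  chains.\<close>

lemma koszul_carrier_eq: "koszul_carrier R n = lift_chain ` chains"
proof
  show "lift_chain ` chains \<subseteq> koszul_carrier R n"
    using lift_chain_in_carrier by blast
  show "koszul_carrier R n \<subseteq> lift_chain ` chains"
  proof
    fix z assume z: "z \<in> koszul_carrier R n"
    have "carrier R = proj ` carrier S"
      unfolding quotient_ring_def FactRing_def A_RCOSETS_defs proj_eq a_r_coset_def by auto
    then have "\<forall>\<sigma>. \<exists>f\<in>carrier S. \<sigma> \<subseteq> {1..n} \<longrightarrow> z \<sigma> = proj f"
      using z unfolding koszul_carrier_def by (fastforce simp: PiE_iff)
    then obtain c where c: "\<forall>\<sigma>. c \<sigma> \<in> carrier S \<and> (\<sigma> \<subseteq> {1..n} \<longrightarrow> z \<sigma> = proj (c \<sigma>))"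
      by metis
    then have "z = lift_chain c"
      using z unfolding koszul_carrier_def lift_chain_def
      by (auto simp: fun_eq_iff PiE_iff extensional_def)
    moreover have "c \<in> chains" using c by (simp add: chains_def)
    ultimately show "z \<in> lift_chain ` chains" by blast
  qed
qed

lemma koszul_diff_lift:
  assumes "c \<in> chains"
  shows "koszul_diff R n X (lift_chain c) = lift_chain (kdiff n var c)"
  unfolding koszul_diff_def lift_chain_def
proof (rule restrict_ext)
  fix \<tau> assume \<tau>: "\<tau> \<in> Pow {1..n}"
  have c: "c (insert i \<tau>) \<in> carrier S" if "i \<in> {1..n} - \<tau>" for i
    using assms \<tau> that by (auto simp: chains_def)
  have "proj (kdiff n var c \<tau>) =
      (\<Oplus>\<^bsub>R\<^esub>i\<in>{1..n} - \<tau>. proj ((-1) ^ below \<tau> i * (var i * c (insert i \<tau>))))"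
    unfolding kdiff_def using c by (intro proj_sum) auto
  also have "\<dots> = (\<Oplus>\<^bsub>R\<^esub>i\<in>{1..n} - \<tau>. (\<ominus>\<^bsub>R\<^esub> \<one>\<^bsub>R\<^esub>) [^]\<^bsub>R\<^esub> card {j \<in> \<tau>. j < i} \<otimes>\<^bsub>R\<^esub>
      (X i \<otimes>\<^bsub>R\<^esub> (\<lambda>\<sigma>\<in>Pow {1..n}. proj (c \<sigma>)) (insert i \<tau>)))"
    using c \<tau> by (intro proj.S.finsum_cong') (auto simp: sign_eq_proj proj_mult below_def)
  finally show "(\<Oplus>\<^bsub>R\<^esub>i\<in>{1..n} - \<tau>. (\<ominus>\<^bsub>R\<^esub> \<one>\<^bsub>R\<^esub>) [^]\<^bsub>R\<^esub> card {j \<in> \<tau>. j < i} \<otimes>\<^bsub>R\<^esub>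
      (X i \<otimes>\<^bsub>R\<^esub> (\<lambda>\<sigma>\<in>Pow {1..n}. proj (c \<sigma>)) (insert i \<tau>))) = proj (kdiff n var c \<tau>)"
    by simp
qed

lemma koszul_wedge_lift:
  assumes "c \<in> chains" "d \<in> chains"
  shows "koszul_wedge R n (lift_chain c) (lift_chain d) = lift_chain (kwedge c d)"
  unfolding koszul_wedge_def lift_chain_def
proof (rule restrict_ext)
  fix \<rho> :: "nat set" assume \<rho>: "\<rho> \<in> Pow {1..n}"
  have c: "\<sigma> \<subseteq> {1..n}" "\<rho> - \<sigma> \<subseteq> {1..n}" "c \<sigma> \<in> carrier S" "d (\<rho> - \<sigma>) \<in> carrier S"
    if "\<sigma> \<in> Pow \<rho>" for \<sigma>
    using assms \<rho> that by (auto intro!: chainsD)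
  have "proj (kwedge c d \<rho>) =
      (\<Oplus>\<^bsub>R\<^esub>\<sigma>\<in>Pow \<rho>. proj ((-1) ^ inversions \<sigma> (\<rho> - \<sigma>) * (c \<sigma> * d (\<rho> - \<sigma>))))"
    unfolding kwedge_def using c by (intro proj_sum) auto
  also have "\<dots> = (\<Oplus>\<^bsub>R\<^esub>\<sigma>\<in>Pow \<rho>. shuffle_sign R \<sigma> (\<rho> - \<sigma>) \<otimes>\<^bsub>R\<^esub>
      ((\<lambda>\<sigma>\<in>Pow {1..n}. proj (c \<sigma>)) \<sigma> \<otimes>\<^bsub>R\<^esub> (\<lambda>\<sigma>\<in>Pow {1..n}. proj (d \<sigma>)) (\<rho> - \<sigma>)))"
    using c by (intro proj.S.finsum_cong')
      (auto simp: sign_eq_proj proj_mult shuffle_sign_def inversions_def)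
  finally show "(\<Oplus>\<^bsub>R\<^esub>\<sigma>\<in>Pow \<rho>. shuffle_sign R \<sigma> (\<rho> - \<sigma>) \<otimes>\<^bsub>R\<^esub>
      ((\<lambda>\<sigma>\<in>Pow {1..n}. proj (c \<sigma>)) \<sigma> \<otimes>\<^bsub>R\<^esub> (\<lambda>\<sigma>\<in>Pow {1..n}. proj (d \<sigma>)) (\<rho> - \<sigma>))) =
      proj (kwedge c d \<rho>)"
    by simp
qed

lemma zero_koszul_algebra: "\<zero>\<^bsub>koszul_algebra R n\<^esub> = lift_chain (\<lambda>_. 0)"
  by (simp add: koszul_algebra_def lift_chain_def proj_zero)

lemma koszul_add_lift:
  assumes "c \<in> chains" "d \<in> chains"
  shows "lift_chain c \<oplus>\<^bsub>koszul_cycle_algebra R n x\<^esub> lift_chain d = lift_chain (\<lambda>\<sigma>. c \<sigma> + d \<sigma>)"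
  using assms unfolding koszul_cycle_algebra_def koszul_algebra_def lift_chain_def chains_def
  by (auto simp: fun_eq_iff proj_add)

lemma lift_in_koszul_cycles_iff:
  assumes "c \<in> chains"
  shows "lift_chain c \<in> koszul_cycles R n X \<longleftrightarrow> (\<forall>\<tau>\<subseteq>{1..n}. kdiff n var c \<tau> \<in> I)"
  using assms lift_chain_eq_iff[OF kdiff_chains[OF assms], of "\<lambda>_. 0"]
  by (simp add: koszul_cycles_def lift_chain_in_carrier koszul_diff_lift zero_koszul_algebra)
    (simp add: chains_def)

lemma koszul_boundaries_eq: "koszul_boundaries R n X = lift_chain ` kdiff n var ` chains"
  unfolding koszul_boundaries_def koszul_carrier_eq by (simp add: image_image koszul_diff_lift)

lemma lift_in_koszul_boundaries_iff:
  assumes "c \<in> chains"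
  shows "lift_chain c \<in> koszul_boundaries R n X \<longleftrightarrow> c \<in> boundaries"
  using assms by (auto simp: koszul_boundaries_eq boundaries_def image_iff lift_chain_eq_iff kdiff_chains)

lemma homology_class_lift:
  assumes "c \<in> chains"
  shows "homology_class R n X (lift_chain c) =
    {lift_chain (\<lambda>\<sigma>. kdiff n var d \<sigma> + c \<sigma>) |d. d \<in> chains}"
  unfolding homology_class_def a_r_coset_def' koszul_boundaries_eq
  using assms by (fastforce simp: koszul_add_lift kdiff_chains)

lemma zero_homology: "\<zero>\<^bsub>koszul_homology R n X\<^esub> = koszul_boundaries R n X"
  by (simp add: koszul_homology_def FactRing_def)

end

section \<open>Bilinearity and chains with a single coefficient\<close>

lemma kdiff_add: "kdiff n x (\<lambda>\<sigma>. c \<sigma> + d \<sigma>) \<tau> = kdiff n x c \<tau> + kdiff n x d \<tau>"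
  unfolding kdiff_def by (simp add: sum.distrib distrib_left)

lemma kdiff_scale: "kdiff n x (\<lambda>\<sigma>. s * c \<sigma>) \<tau> = s * kdiff n x c \<tau>"
  unfolding kdiff_def by (simp add: sum_distrib_left mult.left_commute)

lemma kdiff_zero: "kdiff n x (\<lambda>_. 0) \<tau> = 0"
  unfolding kdiff_def by simp

lemma kwedge_add_left: "kwedge (\<lambda>\<sigma>. c \<sigma> + c' \<sigma>) d \<rho> = kwedge c d \<rho> + kwedge c' d \<rho>"
  unfolding kwedge_def by (simp add: sum.distrib distrib_left distrib_right)

lemma kwedge_add_right: "kwedge c (\<lambda>\<sigma>. d \<sigma> + d' \<sigma>) \<rho> = kwedge c d \<rho> + kwedge c d' \<rho>"
  unfolding kwedge_def by (simp add: sum.distrib distrib_left)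

lemma kwedge_scale_left: "kwedge (\<lambda>\<sigma>. s * c \<sigma>) d \<rho> = s * kwedge c d \<rho>"
  unfolding kwedge_def by (simp add: sum_distrib_left mult.left_commute mult.assoc)

definition single_chain :: "'r::comm_ring_1 \<Rightarrow> nat set \<Rightarrow> nat set \<Rightarrow> 'r" where
  "single_chain f \<sigma> = (\<lambda>\<tau>. if \<tau> = \<sigma> then f else 0)"

lemma kinvol_single_chain:
  "kinvol (single_chain f \<sigma>) = (\<lambda>\<tau>. (-1) ^ card \<sigma> * single_chain f \<sigma> \<tau>)"
  by (simp add: kinvol_def single_chain_def fun_eq_iff)

lemma kdiff_single_chain_face:
  assumes "i \<in> \<sigma>" "\<sigma> \<subseteq> {1..n}"
  shows "kdiff n x (single_chain f \<sigma>) (\<sigma> - {i}) = (-1) ^ below (\<sigma> - {i}) i * (x i * f)"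
proof -
  have i: "i \<in> {1..n} - (\<sigma> - {i})" using assms by blast
  have "single_chain f \<sigma> (insert j (\<sigma> - {i})) = 0" if "j \<in> {1..n} - (\<sigma> - {i}) - {i}" for j
  proof -
    have "i \<notin> insert j (\<sigma> - {i})" using that by blast
    then show ?thesis using assms by (auto simp: single_chain_def)
  qed
  then show ?thesis
    unfolding kdiff_def sum.remove[OF finite_Diff[OF finite_atLeastAtMost] i]
    using assms by (simp add: single_chain_def insert_absorb)
qed

text \<open>A summand survives only for the splitting of \<open>\<rho>\<close> into
  \<open>\<sigma>\<close> and \<open>\<tau>\<close> themselves; when these meet, no
  \<open>\<rho>\<close> splits in this way.\<close>

lemma kwedge_single_chain:
  assumes "finite \<sigma>" "finite \<tau>"
  shows "kwedge (single_chain f \<sigma>) (single_chain g \<tau>) =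
    (if \<sigma> \<inter> \<tau> = {} then single_chain ((-1) ^ inversions \<sigma> \<tau> * (f * g)) (\<sigma> \<union> \<tau>) else (\<lambda>_. 0))"
proof
  fix \<rho>
  have z: "single_chain f \<sigma> \<sigma>' * single_chain g \<tau> (\<rho> - \<sigma>') = 0"
    if "\<not> (\<sigma> \<inter> \<tau> = {} \<and> \<rho> = \<sigma> \<union> \<tau> \<and> \<sigma>' = \<sigma>)" "\<sigma>' \<in> Pow \<rho>" for \<sigma>'
    using that by (auto simp: single_chain_def)
  show "kwedge (single_chain f \<sigma>) (single_chain g \<tau>) \<rho> =
    (if \<sigma> \<inter> \<tau> = {} then single_chain ((-1) ^ inversions \<sigma> \<tau> * (f * g)) (\<sigma> \<union> \<tau>) else (\<lambda>_. 0)) \<rho>"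
  proof (cases "\<sigma> \<inter> \<tau> = {} \<and> \<rho> = \<sigma> \<union> \<tau>")
    case True
    then have fin: "finite (Pow \<rho>)" and mem: "\<sigma> \<in> Pow \<rho>" and diff: "\<rho> - \<sigma> = \<tau>"
      using assms by auto
    have "kwedge (single_chain f \<sigma>) (single_chain g \<tau>) \<rho> = (-1) ^ inversions \<sigma> \<tau> * (f * g)"
      unfolding kwedge_def sum.remove[OF fin mem] diff
      by (subst sum.neutral) (use z in \<open>auto simp: single_chain_def\<close>)
    then show ?thesis using True by (simp add: single_chain_def)
  next
    case False
    then have "kwedge (single_chain f \<sigma>) (single_chain g \<tau>) \<rho> = 0"
      unfolding kwedge_def using z by (intro sum.neutral ballI) (metis mult_zero_right)
    then show ?thesis using False by (auto simp: single_chain_def)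
  qed
qed

section \<open>Boundaries as an ideal in the cycles\<close>

context mpoly_quotient
begin

lemma boundaries_chains: "c \<in> boundaries \<Longrightarrow> c \<in> chains"
  by (simp add: boundaries_def)

lemma boundariesI:
  assumes "c \<in> chains" "d \<in> chains" "\<And>\<tau>. \<tau> \<subseteq> {1..n} \<Longrightarrow> c \<tau> - kdiff n var d \<tau> \<in> I"
  shows "c \<in> boundaries"
  using assms unfolding boundaries_def by blast

lemma zero_chain: "(\<lambda>_. 0) \<in> chains"
  by (simp add: chains_def)

lemma scale_chain: "s \<in> carrier S \<Longrightarrow> c \<in> chains \<Longrightarrow> (\<lambda>\<sigma>. s * c \<sigma>) \<in> chains"
  unfolding chains_def by auto

lemma add_boundaries:
  assumes "c \<in> boundaries" "d \<in> boundaries"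
  shows "(\<lambda>\<sigma>. c \<sigma> + d \<sigma>) \<in> boundaries"
proof -
  obtain c' d' where *: "c' \<in> chains" "d' \<in> chains"
      "\<And>\<tau>. \<tau> \<subseteq> {1..n} \<Longrightarrow> c \<tau> - kdiff n var c' \<tau> \<in> I"
      "\<And>\<tau>. \<tau> \<subseteq> {1..n} \<Longrightarrow> d \<tau> - kdiff n var d' \<tau> \<in> I"
    using assms unfolding boundaries_def by blast
  show ?thesis
  proof (rule boundariesI)
    show "(\<lambda>\<sigma>. c' \<sigma> + d' \<sigma>) \<in> chains" by (rule add_chains) fact+
    fix \<tau> :: "nat set" assume "\<tau> \<subseteq> {1..n}"
    from I_closed(1)[OF *(3,4)[OF this]]
    show "c \<tau> + d \<tau> - kdiff n var (\<lambda>\<sigma>. c' \<sigma> + d' \<sigma>) \<tau> \<in> I"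
      by (simp add: kdiff_add algebra_simps)
  qed (use assms add_chains boundaries_chains in blast)
qed

lemma scale_boundaries:
  assumes "s \<in> carrier S" "c \<in> boundaries"
  shows "(\<lambda>\<sigma>. s * c \<sigma>) \<in> boundaries"
proof -
  obtain c' where *: "c' \<in> chains" "\<And>\<tau>. \<tau> \<subseteq> {1..n} \<Longrightarrow> c \<tau> - kdiff n var c' \<tau> \<in> I"
    using assms unfolding boundaries_def by blast
  show ?thesis
  proof (rule boundariesI)
    show "(\<lambda>\<sigma>. s * c' \<sigma>) \<in> chains" by (rule scale_chain) fact+
    fix \<tau> :: "nat set" assume "\<tau> \<subseteq> {1..n}"
    from I_closed(3)[OF *(2)[OF this] assms(1)]
    show "s * c \<tau> - kdiff n var (\<lambda>\<sigma>. s * c' \<sigma>) \<tau> \<in> I"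
      by (simp add: kdiff_scale right_diff_distrib)
  qed (use assms scale_chain boundaries_chains in blast)
qed

lemma kdiff_boundary: "c \<in> chains \<Longrightarrow> kdiff n var c \<in> boundaries"
  by (rule boundariesI[of _ c]) (simp_all add: kdiff_chains I_closed)

lemma kwedge_in_I_right:
  assumes "c \<in> chains" "\<And>\<tau>. \<tau> \<subseteq> {1..n} \<Longrightarrow> d \<tau> \<in> I" "\<rho> \<subseteq> {1..n}"
  shows "kwedge c d \<rho> \<in> I"
  unfolding kwedge_def using assms(3)
  by (intro I_sum I_closed(3) assms(2) mpoly_ring_sign chainsD[OF assms(1)]) auto

lemma kwedge_in_I_left:
  assumes "d \<in> chains" "\<And>\<tau>. \<tau> \<subseteq> {1..n} \<Longrightarrow> c \<tau> \<in> I" "\<rho> \<subseteq> {1..n}"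
  shows "kwedge c d \<rho> \<in> I"
  unfolding kwedge_def using assms(3)
  by (intro I_sum I_closed(3) I_closed(4) assms(2) mpoly_ring_sign chainsD[OF assms(1)]) auto

text \<open>By the Leibniz rule the differential of \<open>kwedge c d\<close> differs from the given
  chain by a wedge with \<open>kdiff n var d\<close>, which has coefficients in I because
  \<open>d\<close> is a cycle.\<close>

lemma kwedge_boundary_left:
  assumes "c \<in> chains" "d \<in> cycles"
  shows "kwedge (kdiff n var c) d \<in> boundaries"
proof (rule boundariesI)
  have d: "d \<in> chains" using assms(2) by (simp add: cycles_def)
  show "kwedge (kdiff n var c) d \<in> chains" "kwedge c d \<in> chains"
    using assms(1) d by (simp_all add: kwedge_chains kdiff_chains)
  fix \<rho> :: "nat set" assume \<rho>: "\<rho> \<subseteq> {1..n}"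
  have "kwedge (kinvol c) (kdiff n var d) \<rho> \<in> I"
    using assms \<rho> by (intro kwedge_in_I_right) (auto simp: kinvol_chains cycles_def)
  from I_closed(5)[OF this]
  show "kwedge (kdiff n var c) d \<rho> - kdiff n var (kwedge c d) \<rho> \<in> I"
    using \<rho> by (simp add: kdiff_kwedge)
qed

lemma kwedge_boundary_right:
  assumes "c \<in> cycles" "d \<in> chains"
  shows "kwedge (kinvol c) (kdiff n var d) \<in> boundaries"
proof (rule boundariesI)
  have c: "c \<in> chains" using assms(1) by (simp add: cycles_def)
  show "kwedge (kinvol c) (kdiff n var d) \<in> chains" "kwedge c d \<in> chains"
    using assms(2) c by (simp_all add: kwedge_chains kdiff_chains kinvol_chains)
  fix \<rho> :: "nat set" assume \<rho>: "\<rho> \<subseteq> {1..n}"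
  have "kwedge (kdiff n var c) d \<rho> \<in> I"
    using assms \<rho> by (intro kwedge_in_I_left) (auto simp: cycles_def)
  from I_closed(5)[OF this]
  show "kwedge (kinvol c) (kdiff n var d) \<rho> - kdiff n var (kwedge c d) \<rho> \<in> I"
    using \<rho> by (simp add: kdiff_kwedge)
qed

lemma kdiff_add_cycle:
  assumes "a \<in> chains" "c \<in> cycles"
  shows "(\<lambda>\<sigma>. kdiff n var a \<sigma> + c \<sigma>) \<in> cycles"
  using assms unfolding cycles_def
  by (auto simp: add_chains kdiff_chains kdiff_add kdiff_kdiff finite_subset)

text \<open>The Leibniz rule yields boundaries with \<open>kinvol c\<close> as left factor, whereas
  the product has \<open>c\<close>. The hypotheses on \<open>s\<close> express homogeneity of
  \<open>c\<close>: the involution acts as multiplication by a sign, which a second multiplication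
  undoes.\<close>

lemma kwedge_homologous:
  assumes a: "a \<in> chains" and b: "b \<in> chains" and c: "c \<in> cycles" and d: "d \<in> cycles"
    and inv: "kinvol c = (\<lambda>\<sigma>. s * c \<sigma>)" "s \<in> carrier S" "s * s = 1"
    and cd: "kwedge c d \<in> boundaries"
  shows "kwedge (\<lambda>\<sigma>. kdiff n var a \<sigma> + c \<sigma>) (\<lambda>\<sigma>. kdiff n var b \<sigma> + d \<sigma>) \<in> boundaries"
proof -
  let ?d = "\<lambda>\<sigma>. kdiff n var b \<sigma> + d \<sigma>"
  have 1: "kwedge (kdiff n var a) ?d \<in> boundaries"
    by (intro kwedge_boundary_left kdiff_add_cycle) fact+
  have "(\<lambda>\<rho>. s * kwedge (kinvol c) (kdiff n var b) \<rho>) \<in> boundaries"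
    by (intro scale_boundaries kwedge_boundary_right) fact+
  moreover have "(\<lambda>\<rho>. s * kwedge (kinvol c) (kdiff n var b) \<rho>) = kwedge c (kdiff n var b)"
    using inv(3) by (simp add: inv(1) kwedge_scale_left mult.assoc[symmetric])
  ultimately have 2: "kwedge c (kdiff n var b) \<in> boundaries" by simp
  have "(\<lambda>\<rho>. kwedge (kdiff n var a) ?d \<rho> + (kwedge c (kdiff n var b) \<rho> + kwedge c d \<rho>)) \<in> boundaries"
    by (intro add_boundaries 1 2 cd)
  then show ?thesis
    by (simp add: kwedge_add_left[abs_def] kwedge_add_right[abs_def])
qed

text \<open>The product in \<open>FactRing\<close> is the union of the cosets of all products of
  representatives. Its vanishing is thus an equality of this union with the set of boundaries: one
  inclusion is independence of representatives, the other says that the union exhausts the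
  boundaries.\<close>

lemma homology_mult_eq_zero_iff:
  assumes c: "c \<in> cycles" and d: "d \<in> cycles"
    and inv: "kinvol c = (\<lambda>\<sigma>. s * c \<sigma>)" "s \<in> carrier S" "s * s = 1"
  shows "homology_class R n X (lift_chain c) \<otimes>\<^bsub>koszul_homology R n X\<^esub> homology_class R n X (lift_chain d)
      = \<zero>\<^bsub>koszul_homology R n X\<^esub> \<longleftrightarrow> kwedge c d \<in> boundaries" (is "?P = _ \<longleftrightarrow> _")
proof -
  let ?shift = "\<lambda>a c \<sigma>. kdiff n var a \<sigma> + c \<sigma>"
  have cc: "c \<in> chains" "d \<in> chains" using c d by (simp_all add: cycles_def)
  have sh: "?shift a c' \<in> chains" if "a \<in> chains" "c' \<in> chains" for a c'
    using that by (simp add: add_chains kdiff_chains)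
  have "?P = (\<Union>z\<in>homology_class R n X (lift_chain c). \<Union>w\<in>homology_class R n X (lift_chain d).
      homology_class R n X (koszul_wedge R n z w))"
    by (simp add: koszul_homology_def FactRing_def rcoset_mult_def homology_class_def
        koszul_cycle_algebra_def koszul_algebra_def)
  also have "\<dots> = {lift_chain (?shift g (kwedge (?shift a c) (?shift b d))) |g a b.
      g \<in> chains \<and> a \<in> chains \<and> b \<in> chains}"
    unfolding homology_class_lift[OF cc(1)] homology_class_lift[OF cc(2)]
    by (fastforce simp: koszul_wedge_lift homology_class_lift kwedge_chains sh cc)
  finally have P: "?P = \<dots>" .
  show ?thesis
  proof
    assume "?P = \<zero>\<^bsub>koszul_homology R n X\<^esub>"
    \<comment> \<open>All three shifts are taken to be 0, which leaves the product of the given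
      representatives.\<close>
    then have "lift_chain (?shift (\<lambda>_. 0) (kwedge (?shift (\<lambda>_. 0) c) (?shift (\<lambda>_. 0) d)))
        \<in> koszul_boundaries R n X"
      unfolding P zero_homology using zero_chain by blast
    then have "lift_chain (kwedge c d) \<in> koszul_boundaries R n X"
      by (simp add: kdiff_zero)
    then show "kwedge c d \<in> boundaries"
      by (simp add: lift_in_koszul_boundaries_iff kwedge_chains cc)
  next
    assume b: "kwedge c d \<in> boundaries"
    show "?P = \<zero>\<^bsub>koszul_homology R n X\<^esub>"
      unfolding P zero_homology
    proof (intro equalityI subsetI)
      fix y assume "y \<in> {lift_chain (?shift g (kwedge (?shift a c) (?shift b d))) |g a b.
        g \<in> chains \<and> a \<in> chains \<and> b \<in> chains}"
      then obtain g a b' where y: "y = lift_chain (?shift g (kwedge (?shift a c) (?shift b' d)))"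
        "g \<in> chains" "a \<in> chains" "b' \<in> chains" by blast
      have "?shift g (kwedge (?shift a c) (?shift b' d)) \<in> boundaries"
        by (intro add_boundaries kdiff_boundary kwedge_homologous[of _ _ _ _ s] y c d inv b)
      then show "y \<in> koszul_boundaries R n X"
        unfolding y(1) using lift_in_koszul_boundaries_iff boundaries_chains by blast
    next
      fix y assume "y \<in> koszul_boundaries R n X"
      then obtain h where h: "h \<in> chains" "y = lift_chain (kdiff n var h)"
        unfolding koszul_boundaries_eq by blast
      obtain k where k: "k \<in> chains" "\<And>\<tau>. \<tau> \<subseteq> {1..n} \<Longrightarrow> kwedge c d \<tau> - kdiff n var k \<tau> \<in> I"
        using b unfolding boundaries_def by blast
      \<comment> \<open>Modulo I the chain \<open>kwedge c d\<close> is the differential of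
        \<open>k\<close>; shifting it by the differential of h - k gives that of
        \<open>h\<close>.\<close>
      define g where "g = (\<lambda>\<sigma>. h \<sigma> + (- 1) * k \<sigma>)"
      have g: "g \<in> chains" unfolding g_def
        using h k by (intro add_chains scale_chain) auto
      have kg: "kdiff n var g \<tau> = kdiff n var h \<tau> - kdiff n var k \<tau>" for \<tau>
        unfolding g_def kdiff_add kdiff_scale by simp
      have "y = lift_chain (?shift g (kwedge c d))"
        unfolding h(2)
      proof (subst lift_chain_eq_iff)
        show "\<forall>\<sigma>\<subseteq>{1..n}. kdiff n var h \<sigma> - (kdiff n var g \<sigma> + kwedge c d \<sigma>) \<in> I"
        proof (intro allI impI)
          fix \<sigma> :: "nat set" assume "\<sigma> \<subseteq> {1..n}"
          from I_closed(5)[OF k(2)[OF this]]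
          show "kdiff n var h \<sigma> - (kdiff n var g \<sigma> + kwedge c d \<sigma>) \<in> I"
            by (simp add: kg algebra_simps)
        qed
      qed (use h g cc in \<open>simp_all add: sh kdiff_chains kwedge_chains\<close>)
      then have "y = lift_chain (?shift g (kwedge (?shift (\<lambda>_. 0) c) (?shift (\<lambda>_. 0) d)))"
        by (simp add: kdiff_zero)
      then show "y \<in> {lift_chain (?shift g (kwedge (?shift a c) (?shift b d))) |g a b.
        g \<in> chains \<and> a \<in> chains \<and> b \<in> chains}"
        using g zero_chain by blast
    qed
  qed
qed

section \<open>Products of monomial cycles\<close>

lemma single_chain_chains: "f \<in> carrier S \<Longrightarrow> single_chain f \<sigma> \<in> chains"
  by (simp add: single_chain_def chains_def)

lemma lift_single_chain: "lift_chain (single_chain f \<sigma>) = basis_chain R n (proj f) \<sigma>"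
  by (auto simp: lift_chain_def basis_chain_def single_chain_def fun_eq_iff proj_zero)

lemma I_sign_iff:
  assumes "f \<in> carrier S"
  shows "(-1) ^ k * f \<in> I \<longleftrightarrow> f \<in> I"
proof
  assume "(-1) ^ k * f \<in> I"
  then show "f \<in> I"
    using I_closed(5)[of "- f"] by (cases "even k") simp_all
qed (simp add: I_closed(3))

text \<open>The faces of \<open>\<sigma>\<close> obtained by removing different indices are
  different basis elements, so their coefficients cannot cancel and each must lie in I by
  itself.\<close>

lemma single_chain_cycle_iff:
  assumes "f \<in> carrier S" "\<sigma> \<subseteq> {1..n}"
  shows "single_chain f \<sigma> \<in> cycles \<longleftrightarrow> (\<forall>i\<in>\<sigma>. var i * f \<in> I)"
proof
  assume c: "single_chain f \<sigma> \<in> cycles"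
  show "\<forall>i\<in>\<sigma>. var i * f \<in> I"
  proof
    fix i assume i: "i \<in> \<sigma>"
    then have "(-1) ^ below (\<sigma> - {i}) i * (var i * f) \<in> I"
      using c assms kdiff_single_chain_face[OF i assms(2), of var f]
      unfolding cycles_def by (auto dest!: spec[of _ "\<sigma> - {i}"])
    then show "var i * f \<in> I"
      using assms i by (subst (asm) I_sign_iff) auto
  qed
next
  assume f: "\<forall>i\<in>\<sigma>. var i * f \<in> I"
  have "kdiff n var (single_chain f \<sigma>) \<tau> \<in> I" for \<tau>
    unfolding kdiff_def
  proof (rule I_sum)
    fix i assume "i \<in> {1..n} - \<tau>"
    have "var i * single_chain f \<sigma> (insert i \<tau>) \<in> I"
      using f by (auto simp: single_chain_def I_closed)
    then show "(-1) ^ below \<tau> i * (var i * single_chain f \<sigma> (insert i \<tau>)) \<in> I"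
      by (simp add: I_closed)
  qed
  then show "single_chain f \<sigma> \<in> cycles"
    using assms by (simp add: cycles_def single_chain_chains)
qed

lemma single_chain_sign_boundary_iff:
  "single_chain ((-1) ^ k * f) \<rho> \<in> boundaries \<longleftrightarrow> single_chain f \<rho> \<in> boundaries"
proof -
  have eq: "(\<lambda>\<sigma>. s * single_chain f \<rho> \<sigma>) = single_chain (s * f) \<rho>" for s f
    by (simp add: single_chain_def fun_eq_iff)
  show ?thesis
    using scale_boundaries[of "(-1) ^ k" "single_chain f \<rho>"]
      scale_boundaries[of "(-1) ^ k" "single_chain ((-1) ^ k * f) \<rho>"]
    by (auto simp: eq mult.assoc[symmetric] power_mult_distrib[symmetric])
qed

text \<open>From here on homology classes no longer occur; what remains is which monomial chains are
  in \<open>boundaries\<close>. Overlapping \<open>\<sigma>\<close> and \<open>\<tau>\<close> have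
  wedge 0, and the sign of the wedge does not affect membership.\<close>

lemma products_vanish_iff:
  "monomial_cycle_products_vanish n I \<longleftrightarrow>
    (\<forall>a \<in> exponents n. \<forall>b \<in> exponents n. \<forall>\<sigma> \<tau>.
      \<sigma> \<subseteq> {1..n} \<and> \<tau> \<subseteq> {1..n} \<and> \<sigma> \<noteq> {} \<and> \<tau> \<noteq> {} \<and> \<sigma> \<inter> \<tau> = {} \<and>
      (\<forall>i\<in>\<sigma>. var i * monomial a \<in> I) \<and> (\<forall>j\<in>\<tau>. var j * monomial b \<in> I) \<longrightarrow>
      single_chain (monomial (a + b)) (\<sigma> \<union> \<tau>) \<in> boundaries)" (is "_ \<longleftrightarrow> ?rhs")
proof -
  let ?M = "{(a, \<sigma>). a \<in> exponents n \<and> \<sigma> \<subseteq> {1..n} \<and> \<sigma> \<noteq> {} \<and> (\<forall>i\<in>\<sigma>. var i * monomial a \<in> I)}"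
  let ?c = "\<lambda>(a, \<sigma>). single_chain (monomial a) \<sigma>"
  have M: "positive_monomial_cycles n I = (\<lambda>p. lift_chain (?c p)) ` ?M"
  proof -
    have cyc: "lift_chain (single_chain (monomial a) \<sigma>) \<in> koszul_cycles R n X \<longleftrightarrow>
        (\<forall>i\<in>\<sigma>. var i * monomial a \<in> I)" if "a \<in> exponents n" "\<sigma> \<subseteq> {1..n}" for a \<sigma>
      using that single_chain_cycle_iff[of "monomial a" \<sigma>]
      by (simp add: lift_in_koszul_cycles_iff single_chain_chains cycles_def)
    have card: "card \<sigma> \<ge> 1 \<longleftrightarrow> \<sigma> \<noteq> {}" if "\<sigma> \<subseteq> {1..n}" for \<sigma> :: "nat set"
      using finite_subset[OF that] by (simp add: Suc_le_eq card_gt_0_iff)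
    have "positive_monomial_cycles n I = {z. \<exists>p. p \<in> ?M \<and> z = lift_chain (?c p)}"
      unfolding positive_monomial_cycles_def lift_single_chain[symmetric]
    proof (intro Collect_cong iffI)
      fix z
      assume "\<exists>m\<in>exponents n. \<exists>\<sigma>\<subseteq>{1..n}. 1 \<le> card \<sigma> \<and>
        z = lift_chain (single_chain (monomial m) \<sigma>) \<and> z \<in> koszul_cycles R n X"
      then obtain m \<sigma> where *: "m \<in> exponents n" "\<sigma> \<subseteq> {1..n}" "1 \<le> card \<sigma>"
        "z = lift_chain (single_chain (monomial m) \<sigma>)" "z \<in> koszul_cycles R n X" by blast
      then have "(m, \<sigma>) \<in> ?M" using cyc card by simp
      then show "\<exists>p. p \<in> ?M \<and> z = lift_chain (?c p)" using *(4) by (intro exI[of _ "(m, \<sigma>)"]) simp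
    next
      fix z
      assume "\<exists>p. p \<in> ?M \<and> z = lift_chain (?c p)"
      then obtain m \<sigma> where *: "m \<in> exponents n" "\<sigma> \<subseteq> {1..n}" "\<sigma> \<noteq> {}"
        "\<forall>i\<in>\<sigma>. var i * monomial m \<in> I" "z = lift_chain (single_chain (monomial m) \<sigma>)" by auto
      then have "1 \<le> card \<sigma>" "z \<in> koszul_cycles R n X"
        using card[OF *(2)] cyc[OF *(1,2)] by simp_all
      with * show "\<exists>m\<in>exponents n. \<exists>\<sigma>\<subseteq>{1..n}. 1 \<le> card \<sigma> \<and>
        z = lift_chain (single_chain (monomial m) \<sigma>) \<and> z \<in> koszul_cycles R n X" by blast
    qed
    then show ?thesis by blast
  qed
  have eq: "(homology_class R n X (lift_chain (?c p)) \<otimes>\<^bsub>koszul_homology R n X\<^esub>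
      homology_class R n X (lift_chain (?c q)) = \<zero>\<^bsub>koszul_homology R n X\<^esub>) \<longleftrightarrow>
      kwedge (?c p) (?c q) \<in> boundaries" if "p \<in> ?M" "q \<in> ?M" for p q
    using that
    by (intro homology_mult_eq_zero_iff[where s = "(-1) ^ card (snd p)"])
      (auto simp: single_chain_cycle_iff kinvol_single_chain power_mult_distrib[symmetric])
  have "monomial_cycle_products_vanish n I \<longleftrightarrow>
      (\<forall>p\<in>?M. \<forall>q\<in>?M. homology_class R n X (lift_chain (?c p)) \<otimes>\<^bsub>koszul_homology R n X\<^esub>
      homology_class R n X (lift_chain (?c q)) = \<zero>\<^bsub>koszul_homology R n X\<^esub>)"
    unfolding monomial_cycle_products_vanish_def Let_def M by (simp only: ball_simps(9))
  also have "\<dots> \<longleftrightarrow> (\<forall>p\<in>?M. \<forall>q\<in>?M. kwedge (?c p) (?c q) \<in> boundaries)"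
    using eq by (intro ball_cong refl)
  also have "\<dots> \<longleftrightarrow> ?rhs"
  proof -
    have *: "kwedge (single_chain (monomial a) \<sigma>) (single_chain (monomial b) \<tau>) \<in> boundaries \<longleftrightarrow>
        (\<sigma> \<inter> \<tau> = {} \<longrightarrow> single_chain (monomial (a + b)) (\<sigma> \<union> \<tau>) \<in> boundaries)"
      if "\<sigma> \<subseteq> {1..n}" "\<tau> \<subseteq> {1..n}" for a b \<sigma> \<tau>
    proof -
      have "(\<lambda>_. 0) \<in> boundaries"
        by (rule boundariesI[OF zero_chain zero_chain]) (simp add: kdiff_zero I_closed)
      then show ?thesis
        using that[THEN finite_subset]
        by (simp add: kwedge_single_chain single_chain_sign_boundary_iff monomial_add)
    qed
    show ?thesis
    proof (intro iffI ballI allI impI)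
      fix a b \<sigma> \<tau>
      assume all: "\<forall>p\<in>?M. \<forall>q\<in>?M. kwedge (?c p) (?c q) \<in> boundaries"
        and ab: "a \<in> exponents n" "b \<in> exponents n"
        and st: "\<sigma> \<subseteq> {1..n} \<and> \<tau> \<subseteq> {1..n} \<and> \<sigma> \<noteq> {} \<and> \<tau> \<noteq> {} \<and> \<sigma> \<inter> \<tau> = {} \<and>
          (\<forall>i\<in>\<sigma>. var i * monomial a \<in> I) \<and> (\<forall>j\<in>\<tau>. var j * monomial b \<in> I)"
      have "(a, \<sigma>) \<in> ?M" "(b, \<tau>) \<in> ?M" using ab st by simp_all
      with all have "kwedge (?c (a, \<sigma>)) (?c (b, \<tau>)) \<in> boundaries" by blast
      then show "single_chain (monomial (a + b)) (\<sigma> \<union> \<tau>) \<in> boundaries"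
        using *[of \<sigma> \<tau> a b] st by simp
    next
      fix p q assume rhs: ?rhs and "p \<in> ?M" "q \<in> ?M"
      then obtain a b \<sigma> \<tau> where pq: "p = (a, \<sigma>)" "q = (b, \<tau>)"
        and ab: "a \<in> exponents n" "b \<in> exponents n"
        and st: "\<sigma> \<subseteq> {1..n}" "\<tau> \<subseteq> {1..n}" "\<sigma> \<noteq> {}" "\<tau> \<noteq> {}"
          "\<forall>i\<in>\<sigma>. var i * monomial a \<in> I" "\<forall>j\<in>\<tau>. var j * monomial b \<in> I" by auto
      have "\<sigma> \<inter> \<tau> = {} \<longrightarrow> single_chain (monomial (a + b)) (\<sigma> \<union> \<tau>) \<in> boundaries"
        using rhs[rule_format, OF ab, of \<sigma> \<tau>] st by blast
      then show "kwedge (?c p) (?c q) \<in> boundaries"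
        using *[of \<sigma> \<tau> a b] st by (simp add: pq)
    qed
  qed
  finally show ?thesis .
qed

end

section \<open>Symmetric monomial ideals\<close>

abbreviation unit_exp :: "nat \<Rightarrow> nat \<Rightarrow>\<^sub>0 nat" where
  "unit_exp i \<equiv> Poly_Mapping.single i (Suc 0)"

lemma lookup_unit_exp: "Poly_Mapping.lookup (unit_exp i) k = (if k = i then 1 else 0)"
  by (simp add: lookup_single when_def)

lemma var_mult_monomial: "var i * (monomial m :: 'k::field mpoly) = monomial (m + unit_exp i)"
  by (simp add: var_def monomial_add mult.commute)

lemma lookup_exponents_outside:
  "m \<in> exponents n \<Longrightarrow> i \<notin> {1..n} \<Longrightarrow> Poly_Mapping.lookup m i = 0"
  unfolding exponents_def by (auto simp: in_keys_iff)

lemma exponentsI: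
  "(\<And>i. i \<notin> {1..n} \<Longrightarrow> Poly_Mapping.lookup m i = 0) \<Longrightarrow> m \<in> exponents n"
  unfolding exponents_def using in_keys_iff by blast

lemma lookup_permute:
  "\<pi> permutes N \<Longrightarrow> Poly_Mapping.lookup (Poly_Mapping.map_key \<pi> m) i = Poly_Mapping.lookup m (\<pi> i)"
  by (simp add: map_key.rep_eq permutes_inj)

lemma exponents_permute:
  assumes "\<pi> permutes {1..n}" "m \<in> exponents n"
  shows "Poly_Mapping.map_key \<pi> m \<in> exponents n"
  using assms by (intro exponentsI) (metis lookup_permute permutes_in_image lookup_exponents_outside)

lemma monomial_mult_key:
  assumes "m \<in> Poly_Mapping.keys (monomial a * (f :: 'k::field mpoly))"
  shows "\<exists>b. m = a + b"
  using assms keys_mult[of "monomial a" f] by (auto simp: monomial_def)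

lemma divides_monomialD:
  assumes "(monomial a :: 'k::field mpoly) divides\<^bsub>mpoly_ring n\<^esub> monomial b"
  shows "Poly_Mapping.lookup a i \<le> Poly_Mapping.lookup b i"
proof -
  obtain f :: "'k mpoly" where "monomial b = monomial a * f"
    using assms unfolding factor_def by auto
  moreover have "b \<in> Poly_Mapping.keys (monomial b :: 'k mpoly)"
    by (simp add: monomial_def)
  ultimately obtain c where "b = a + c" using monomial_mult_key by metis
  then show ?thesis by (simp add: lookup_add)
qed

lemma monomial_ideal_imp_ideal:
  assumes "monomial_ideal n (I :: ('k::field mpoly) set)"
  shows "ideal I (mpoly_ring n)"
proof -
  interpret cring "mpoly_ring n :: ('k mpoly) ring" by (rule cring_mpoly_ring)
  obtain M where "M \<subseteq> exponents n" "I = Idl\<^bsub>mpoly_ring n\<^esub> (monomial ` M)"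
    using assms unfolding monomial_ideal_def by blast
  then show ?thesis by (auto intro!: genideal_ideal)
qed

section \<open>Permutations and partitions\<close>

lemma ex_sorting_permutation:
  fixes n :: nat and f :: "nat \<Rightarrow> nat"
  shows "\<exists>\<pi>. \<pi> permutes {1..n} \<and> antimono_on {1..n} (\<lambda>i. f (\<pi> i))"
proof -
  define ys where "ys = sort_key f [1..<Suc n]"
  have len: "length ys = n" and set: "set ys = {1..n}" and dist: "distinct ys"
    by (simp_all add: ys_def atLeastLessThanSuc_atLeastAtMost del: upt_Suc)
  have sorted: "sorted (map f ys)" by (simp add: ys_def)
  \<comment> \<open>\<open>sort_key\<close> sorts increasingly, so the list is read from its end: i
    = 1 picks the last position n - 1, and i = n picks position 0.\<close>
  define \<pi> where "\<pi> = (\<lambda>i. if i \<in> {1..n} then ys ! (n - i) else i)"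
  have "bij_betw (\<lambda>i. ys ! (n - i)) {1..n} {1..n}"
  proof (rule bij_betw_trans[of "\<lambda>i. n - i" _ "{..<n}" "(!) ys" "{1..n}", unfolded o_def])
    show "bij_betw (\<lambda>i. n - i) {1..n} {..<n}"
      by (rule bij_betw_byWitness[of _ "\<lambda>i. n - i"]) auto
    show "bij_betw ((!) ys) {..<n} {1..n}"
      using bij_betw_nth[OF dist] len set by simp
  qed
  then have "bij_betw \<pi> {1..n} {1..n}"
    by (rule bij_betw_cong[THEN iffD1, rotated]) (simp add: \<pi>_def)
  then have "\<pi> permutes {1..n}"
    by (rule bij_imp_permutes) (auto simp: \<pi>_def)
  moreover have "antimono_on {1..n} (\<lambda>i. f (\<pi> i))"
  proof (rule monotone_onI)
    fix i j assume ij: "i \<in> {1..n}" "j \<in> {1..n}" "i \<le> j"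
    then have "map f ys ! (n - j) \<le> map f ys ! (n - i)"
      using len by (intro sorted_nth_mono[OF sorted]) auto
    then show "f (\<pi> j) \<le> f (\<pi> i)"
      using ij len by (simp add: \<pi>_def)
  qed
  ultimately show ?thesis by blast
qed

text \<open>Used to place a partition of length at most \<open>card \<rho>\<close> on the indices in
  \<open>\<rho>\<close>, with its first term at a prescribed index j.\<close>

lemma ex_permutation_onto_initial_segment:
  assumes "\<rho> \<subseteq> {1..n}" "j \<in> \<rho>"
  shows "\<exists>\<pi>. \<pi> permutes {1..n} \<and> \<pi> ` \<rho> = {1..card \<rho>} \<and> \<pi> j = 1"
proof -
  have fin: "finite \<rho>" using assms finite_subset by blast
  have le: "card \<rho> \<le> n" using card_mono[OF _ assms(1)] by simp
  obtain f where f: "bij_betw f \<rho> {1..card \<rho>}"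
    using finite_same_card_bij[OF fin, of "{1..card \<rho>}"] by auto
  have "card ({1..n} - \<rho>) = card {Suc (card \<rho>)..n}"
    using assms fin by (simp add: card_Diff_subset)
  then obtain g where g: "bij_betw g ({1..n} - \<rho>) {Suc (card \<rho>)..n}"
    using finite_same_card_bij[of "{1..n} - \<rho>" "{Suc (card \<rho>)..n}"] by auto
  define \<pi> where "\<pi> = (\<lambda>i. if i \<in> \<rho> then f i else if i \<in> {1..n} then g i else i)"
  have b1: "bij_betw \<pi> \<rho> {1..card \<rho>}"
    using f by (rule bij_betw_cong[THEN iffD1, rotated]) (simp add: \<pi>_def)
  have b2: "bij_betw \<pi> ({1..n} - \<rho>) {Suc (card \<rho>)..n}"
    using g by (rule bij_betw_cong[THEN iffD1, rotated]) (simp add: \<pi>_def)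
  have "bij_betw \<pi> (\<rho> \<union> ({1..n} - \<rho>)) ({1..card \<rho>} \<union> {Suc (card \<rho>)..n})"
    by (rule bij_betw_combine[OF b1 b2]) auto
  moreover have "\<rho> \<union> ({1..n} - \<rho>) = {1..n}" "{1..card \<rho>} \<union> {Suc (card \<rho>)..n} = {1..n}"
    using assms le by auto
  ultimately have "bij_betw \<pi> {1..n} {1..n}" by simp
  then have p: "\<pi> permutes {1..n}"
    by (rule bij_imp_permutes) (use assms in \<open>auto simp: \<pi>_def\<close>)
  have im: "\<pi> ` \<rho> = {1..card \<rho>}" using b1 by (simp add: bij_betw_def)
  \<comment> \<open>Both swapped values lie in {1..card \<open>\<rho>\<close>}, so the correction at
    j preserves the image of \<open>\<rho>\<close>.\<close>
  define t where "t = transpose (\<pi> j) 1"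
  have j: "\<pi> j \<in> {1..card \<rho>}" using im assms by blast
  have t: "t permutes {1..card \<rho>}" unfolding t_def using j by (intro permutes_swap_id) auto
  then have "t permutes {1..n}" using le by (intro permutes_subset[OF t]) auto
  then have "t \<circ> \<pi> permutes {1..n}" by (rule permutes_compose[OF p])
  moreover have "(t \<circ> \<pi>) ` \<rho> = {1..card \<rho>}"
    by (metis image_comp im permutes_image[OF t])
  moreover have "(t \<circ> \<pi>) j = 1" by (simp add: t_def)
  ultimately show ?thesis by blast
qed

text \<open>Weakly decreasing terms stay 0 from the first 0 on. The length is therefore the number
  of nonzero terms, which, unlike the position of the last one, survives a permutation.\<close>

lemma partition_support:
  assumes "lam \<in> exponent_partitions n"
  shows "{i. part lam i \<noteq> 0} = {1..part_length lam}"
proof -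
  have lam: "lam \<in> exponents n" "antimono_on {1..n} (part lam)"
    using assms by (simp_all add: exponent_partitions_def)
  have sub: "{i. part lam i \<noteq> 0} \<subseteq> {1..n}"
    using lam(1) unfolding exponents_def by (simp only: mem_Collect_eq keys.rep_eq)
  then have fin: "finite {i. part lam i \<noteq> 0}" using finite_subset by blast
  show ?thesis
  proof (intro equalityI subsetI)
    fix i assume "i \<in> {i. part lam i \<noteq> 0}"
    then show "i \<in> {1..part_length lam}"
      using sub fin unfolding part_length_def by (auto intro!: Max_ge)
  next
    fix i assume i: "i \<in> {1..part_length lam}"
    have "part_length lam \<in> insert 0 {i. part lam i \<noteq> 0}"
      unfolding part_length_def by (rule Max_in) (use fin in auto)
    then have nz: "part lam (part_length lam) \<noteq> 0" using i by auto
    then have "part_length lam \<in> {1..n}" using sub by blast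
    then have "part lam (part_length lam) \<le> part lam i"
      using i by (intro monotone_onD[OF lam(2)]) auto
    then show "i \<in> {i. part lam i \<noteq> 0}" using nz by auto
  qed
qed

lemma card_partition_support:
  "lam \<in> exponent_partitions n \<Longrightarrow> card {i. part lam i \<noteq> 0} = part_length lam"
  by (subst partition_support) simp_all

lemma partition_antimono:
  assumes "lam \<in> exponent_partitions n" "1 \<le> i" "i \<le> j"
  shows "part lam j \<le> part lam i"
proof (cases "j \<le> n")
  case True
  then show ?thesis
    using assms unfolding exponent_partitions_def by (auto intro: monotone_onD)
next
  case False
  then show ?thesis
    using assms lookup_exponents_outside[of lam n j] unfolding exponent_partitions_def by simp
qed

text \<open>The exponent vector of a box. For infinite \<open>\<rho>\<close> the sum is 0 by
  default, whence the finiteness assumption on its entries below.\<close>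

definition const_exp :: "nat set \<Rightarrow> nat \<Rightarrow> nat \<Rightarrow>\<^sub>0 nat" where
  "const_exp \<rho> c = (\<Sum>i\<in>\<rho>. Poly_Mapping.single i c)"

lemma lookup_const_exp:
  "finite \<rho> \<Longrightarrow> Poly_Mapping.lookup (const_exp \<rho> c) k = (if k \<in> \<rho> then c else 0)"
  by (simp add: const_exp_def lookup_sum lookup_single when_def sum.delta)

locale symmetric_quotient = mpoly_quotient +
  assumes mono_I: "monomial_ideal n I"
    and sym_I: "\<And>\<pi>. \<pi> permutes {1..n} \<Longrightarrow> permute_vars \<pi> ` I \<subseteq> I"
begin

abbreviation L :: "(nat \<Rightarrow>\<^sub>0 nat) set" where "L \<equiv> generating_partitions n I"

text \<open>The polynomials all of whose monomials lie in I form an ideal \<open>J\<close>. It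
  contains the monomial generators of I and hence all of I.\<close>

lemma monomial_of_key_in_I:
  assumes "f \<in> I" "m \<in> Poly_Mapping.keys f"
  shows "monomial m \<in> I"
proof -
  obtain M where M: "M \<subseteq> exponents n" "I = Idl\<^bsub>S\<^esub> (monomial ` M)"
    using mono_I unfolding monomial_ideal_def by blast
  define J where "J = {f \<in> carrier S. \<forall>m\<in>Poly_Mapping.keys f. monomial m \<in> I}"
  have add: "f + g \<in> J" if "f \<in> J" "g \<in> J" for f g
    using that keys_add[of f g] unfolding J_def by auto
  have mult: "g * f \<in> J" if f: "f \<in> J" and g: "g \<in> carrier S" for f g
  proof -
    have "monomial m \<in> I" if m: "m \<in> Poly_Mapping.keys (g * f)" for m
    proof -
      obtain a b where ab: "a \<in> Poly_Mapping.keys g" "b \<in> Poly_Mapping.keys f" "m = a + b"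
        using keys_mult[of g f] m by blast
      have "a \<in> exponents n" using ab g unfolding carrier_mpoly_ring by blast
      then show ?thesis
        using ab f unfolding J_def by (auto simp: monomial_add intro!: I_closed(3))
    qed
    then show ?thesis using f g unfolding J_def by auto
  qed
  have mult': "f * g \<in> J" if "f \<in> J" "g \<in> carrier S" for f g
    using mult[OF that] by (simp add: mult.commute)
  have "subgroup J (add_monoid S)"
  proof (rule I.add.subgroupI)
    show "J \<subseteq> carrier S" unfolding J_def by blast
    have "0 \<in> J" unfolding J_def by simp
    then show "J \<noteq> {}" by blast
    fix a assume a: "a \<in> J"
    then have "a \<in> carrier S" unfolding J_def by blast
    then show "\<ominus>\<^bsub>S\<^esub> a \<in> J" using mult[OF a, of "- 1"] by simp
    fix b assume "b \<in> J"
    then show "a \<oplus>\<^bsub>S\<^esub> b \<in> J" using add[OF a] by simp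
  qed
  then have "ideal J S"
    by (intro idealI I.ring_axioms) (simp_all add: mult mult')
  moreover have "monomial ` M \<subseteq> J"
  proof
    fix f :: "'a mpoly" assume "f \<in> monomial ` M"
    then obtain m where m: "m \<in> M" "f = monomial m" by blast
    have "monomial ` M \<subseteq> carrier S" using M(1) by auto
    from I.genideal_self[OF this] have "f \<in> I" using m M(2) by blast
    then show "f \<in> J" using m M(1) unfolding J_def by (auto simp: monomial_def)
  qed
  ultimately have "I \<subseteq> J" unfolding M(2) by (rule I.genideal_minimal)
  then show ?thesis using assms unfolding J_def by blast
qed

lemma monomial_upward_closed:
  assumes "monomial a \<in> I" "b \<in> exponents n"
    and le: "\<And>i. Poly_Mapping.lookup a i \<le> Poly_Mapping.lookup b i"
  shows "monomial b \<in> I"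
proof -
  have "b = (b - a) + a"
    by (rule poly_mapping_eqI) (simp add: lookup_add lookup_minus le)
  then have "monomial b = monomial (b - a) * (monomial a :: 'a mpoly)"
    using monomial_add[of "b - a" a] by simp
  then show ?thesis
    using assms by (simp add: I_closed(3) exponents_minus)
qed

text \<open>\<open>permute_vars\<close> undoes \<open>map_key\<close> for the same permutation, so
  symmetry of I has to be applied with the inverse of \<open>\<pi>\<close>.\<close>

lemma monomial_permute:
  assumes \<pi>: "\<pi> permutes {1..n}" and "monomial m \<in> I"
  shows "monomial (Poly_Mapping.map_key \<pi> m) \<in> I"
proof -
  let ?q = "inv_into UNIV \<pi>"
  have q: "?q permutes {1..n}" using \<pi> by (rule permutes_inv)
  have "Poly_Mapping.map_key ?q (Poly_Mapping.map_key \<pi> m) = m"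
    by (rule poly_mapping_eqI) (simp add: lookup_permute[OF q] lookup_permute[OF \<pi>] permutes_inverses[OF \<pi>])
  then have "permute_vars ?q (monomial m) = (monomial (Poly_Mapping.map_key \<pi> m) :: 'a mpoly)"
    using permute_vars_monomial[OF permutes_bij[OF q], of "Poly_Mapping.map_key \<pi> m"] by simp
  then show ?thesis using sym_I[OF q] assms(2) by (metis image_subset_iff)
qed

lemma monomial_permute_le:
  assumes "monomial a \<in> I" "\<pi> permutes {1..n}" "b \<in> exponents n"
    and "\<And>i. Poly_Mapping.lookup a (\<pi> i) \<le> Poly_Mapping.lookup b i"
  shows "monomial b \<in> I"
  using monomial_upward_closed[OF monomial_permute[OF assms(2,1)] assms(3)] assms(4)
  by (simp add: lookup_permute[OF assms(2)])

lemma generating_partitionD: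
  assumes "lam \<in> L"
  shows "lam \<in> exponent_partitions n" "lam \<in> exponents n" "monomial lam \<in> I"
  using assms by (auto simp: generating_partitions_def minimal_generator_exponents_def)

text \<open>Among the monomials of I that divide x^a after a permutation, one of least degree is
  taken and its exponents are sorted. A divisor of the result lying in I is again such a monomial,
  so it cannot have smaller degree.\<close>

lemma ex_generating_partition:
  assumes a: "a \<in> exponents n" "monomial a \<in> I"
  shows "\<exists>lam\<in>L. \<exists>\<pi>. \<pi> permutes {1..n} \<and>
    (\<forall>i. part lam (\<pi> i) \<le> Poly_Mapping.lookup a i)"
proof -
  \<comment> \<open>The permutation is part of the condition, so that neither sorting nor passing to
    a divisor in I leads out of \<open>T\<close>.\<close>
  define T where "T = {b \<in> exponents n. monomial b \<in> I \<and> (\<exists>\<pi>. \<pi> permutes {1..n} \<and>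
    (\<forall>i. Poly_Mapping.lookup b (\<pi> i) \<le> Poly_Mapping.lookup a i))}"
  define w where "w = (\<lambda>b. \<Sum>i\<in>{1..n}. Poly_Mapping.lookup b i :: nat)"
  have "a \<in> T" unfolding T_def using a permutes_id[of "{1..n}"] by fastforce
  then obtain b where b: "b \<in> T" and min: "\<And>c. c \<in> T \<Longrightarrow> w b \<le> w c"
    using ex_has_least_nat[of "\<lambda>b. b \<in> T" a w] by blast
  obtain \<pi> where \<pi>: "\<pi> permutes {1..n}" "antimono_on {1..n} (\<lambda>i. Poly_Mapping.lookup b (\<pi> i))"
    using ex_sorting_permutation by blast
  obtain \<psi> where \<psi>: "\<psi> permutes {1..n}" "\<And>i. Poly_Mapping.lookup b (\<psi> i) \<le> Poly_Mapping.lookup a i"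
    using b unfolding T_def by blast
  define lam where "lam = Poly_Mapping.map_key \<pi> b"
  have lookup: "part lam i = Poly_Mapping.lookup b (\<pi> i)" for i
    by (simp add: lam_def lookup_permute[OF \<pi>(1)])
  have lam: "lam \<in> exponents n" "monomial lam \<in> I"
    using b \<pi> by (simp_all add: lam_def T_def exponents_permute monomial_permute)
  have \<phi>: "inv_into UNIV \<pi> \<circ> \<psi> permutes {1..n}"
    by (intro permutes_compose \<psi> permutes_inv \<pi>)
  have le: "part lam ((inv_into UNIV \<pi> \<circ> \<psi>) i) \<le> Poly_Mapping.lookup a i" for i
    using \<psi>(2)[of i] by (simp add: lookup permutes_inverses[OF \<pi>(1)])
  have w: "w lam = w b"
    unfolding w_def lookup using sum.permute[OF \<pi>(1), of "Poly_Mapping.lookup b"] by (simp add: o_def)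
  have "lam \<in> L"
    unfolding generating_partitions_def minimal_generator_exponents_def exponent_partitions_def
  proof (intro IntI CollectI conjI ballI impI lam)
    show "antimono_on {1..n} (part lam)" using \<pi>(2) by (simp add: lookup[abs_def])
    fix m' assume m': "m' \<in> exponents n"
      "monomial m' \<in> I \<and> (monomial m' :: 'a mpoly) divides\<^bsub>S\<^esub> monomial lam"
    have m'le: "Poly_Mapping.lookup m' i \<le> part lam i" for i
      using divides_monomialD m' by blast
    have "m' \<in> T"
      unfolding T_def using m' \<phi> le m'le order_trans by blast
    \<comment> \<open>Minimality bounds the degree of \<open>m'\<close> below by that of
      \<open>lam\<close>, divisibility bounds it above; equal sums of comparable terms force equal
      terms.\<close>
    then have "w lam \<le> w m'" using min w by simp
    then have "(\<Sum>i\<in>{1..n}. part lam i) = (\<Sum>i\<in>{1..n}. Poly_Mapping.lookup m' i)"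
      unfolding w_def by (rule order.antisym[OF _ sum_mono[OF m'le]])
    then have "\<forall>i\<in>{1..n}. Poly_Mapping.lookup m' i = part lam i"
      using m'le by (metis finite_atLeastAtMost sum_mono_inv)
    then show "m' = lam"
      using lookup_exponents_outside m'(1) lam(1) by (metis poly_mapping_eqI)
  qed
  with \<phi> le show ?thesis by blast
qed

section \<open>Monomial chains that are boundaries\<close>

lemma single_chain_boundary_if_in_I:
  "monomial u \<in> I \<Longrightarrow> u \<in> exponents n \<Longrightarrow> single_chain (monomial u) \<rho> \<in> boundaries"
  by (rule boundariesI[OF single_chain_chains zero_chain])
    (simp_all add: kdiff_zero single_chain_def I_closed)

text \<open>Modulo I only the face opposite l of the chain (u / x_l) e_(rho + l) remains, since
  \<open>ex\<close> puts the coefficients of the other faces into I. By \<open>pos\<close> the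
  truncated subtraction is honest division by x_l.\<close>

lemma single_chain_boundary_if_exchange:
  assumes u: "u \<in> exponents n" and \<rho>: "\<rho> \<subseteq> {1..n}" and l: "l \<in> {1..n} - \<rho>"
    and pos: "Poly_Mapping.lookup u l > 0"
    and ex: "\<And>i. i \<in> \<rho> \<Longrightarrow> monomial (u + unit_exp i - unit_exp l) \<in> I"
  shows "single_chain (monomial u) \<rho> \<in> boundaries"
proof -
  define v where "v = u - unit_exp l"
  define e where "e = below \<rho> l"
  \<comment> \<open>The factor (-1)^e is the sign with which removing l from
    \<open>insert l \<rho>\<close> enters the differential; the two signs cancel.\<close>
  define d :: "nat set \<Rightarrow> 'a mpoly" where "d = single_chain ((-1) ^ e * monomial v) (insert l \<rho>)"
  have v: "v \<in> exponents n" using u by (simp add: v_def exponents_minus)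
  have uv: "v + unit_exp l = u"
    unfolding v_def using pos
    by (intro poly_mapping_eqI) (simp add: lookup_add lookup_minus lookup_unit_exp)
  have vi: "v + unit_exp i = u + unit_exp i - unit_exp l" for i
    unfolding v_def using pos
    by (intro poly_mapping_eqI) (simp add: lookup_add lookup_minus lookup_unit_exp)
  show ?thesis
  proof (rule boundariesI)
    show "single_chain (monomial u) \<rho> \<in> chains" using u by (simp add: single_chain_chains)
    show "d \<in> chains" unfolding d_def using v by (intro single_chain_chains) simp
    fix \<tau> :: "nat set" assume \<tau>: "\<tau> \<subseteq> {1..n}"
    show "single_chain (monomial u) \<rho> \<tau> - kdiff n var d \<tau> \<in> I"
    proof (cases "\<tau> = \<rho>")
      case True
      have "insert l \<rho> - {l} = \<rho>" using l by auto
      then have "kdiff n var d \<rho> = (-1) ^ e * (var l * ((-1) ^ e * monomial v))"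
        using kdiff_single_chain_face[of l "insert l \<rho>" n var "(-1) ^ e * monomial v"] l \<rho>
        by (auto simp: d_def e_def)
      also have "\<dots> = ((-1) ^ e * (-1) ^ e) * monomial u"
        unfolding uv[symmetric] var_mult_monomial[symmetric] by (simp add: algebra_simps)
      finally have "kdiff n var d \<rho> = monomial u"
        by (simp add: power_mult_distrib[symmetric])
      then show ?thesis using True by (simp add: single_chain_def I_closed)
    next
      case False
      have "kdiff n var d \<tau> \<in> I"
        unfolding kdiff_def
      proof (rule I_sum)
        fix i assume i: "i \<in> {1..n} - \<tau>"
        have "var i * d (insert i \<tau>) \<in> I"
        proof (cases "insert i \<tau> = insert l \<rho>")
          case True
          \<comment> \<open>As \<open>\<tau>\<close> is not \<open>\<rho>\<close>, the removed index
            is not l, hence one of the indices covered by \<open>ex\<close>.\<close>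
          then have "i \<noteq> l" using False i l insert_ident[of l \<tau> \<rho>] by auto
          then have "i \<in> \<rho>" using True by auto
          then have "var i * monomial v \<in> I"
            using ex vi by (simp add: var_mult_monomial)
          then have "(-1) ^ e * (var i * monomial v) \<in> I" by (simp add: I_closed)
          then show ?thesis using True by (simp add: d_def single_chain_def mult.left_commute)
        qed (simp add: d_def single_chain_def I_closed)
        then show "(-1) ^ below \<tau> i * (var i * d (insert i \<tau>)) \<in> I" by (simp add: I_closed)
      qed
      then show ?thesis using False by (simp add: single_chain_def I_closed)
    qed
  qed
qed

lemma single_chain_not_boundary:
  assumes u: "u \<in> exponents n" and \<rho>: "\<rho> \<subseteq> {1..n}"
    and supp: "\<And>i. i \<notin> \<rho> \<Longrightarrow> Poly_Mapping.lookup u i = 0"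
    and "monomial u \<notin> I"
  shows "single_chain (monomial u) \<rho> \<notin> boundaries"
proof
  assume "single_chain (monomial u) \<rho> \<in> boundaries"
  then obtain d where d: "single_chain (monomial u) \<rho> \<rho> - kdiff n var d \<rho> \<in> I"
    using \<rho> unfolding boundaries_def by blast
  have "u \<notin> Poly_Mapping.keys (var i * f)" if "i \<in> {1..n} - \<rho>" for i and f :: "'a mpoly"
  proof
    assume "u \<in> Poly_Mapping.keys (var i * f)"
    then obtain b where "u = unit_exp i + b"
      unfolding var_def using monomial_mult_key by fastforce
    then have "Poly_Mapping.lookup u i > 0" by (simp add: lookup_add)
    then show False using supp that by simp
  qed
  then have "Poly_Mapping.lookup (kdiff n var d \<rho>) u = 0"
    unfolding kdiff_def lookup_sum mult.left_commute[of "(-1) ^ _" "var _"]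
    by (intro sum.neutral) (simp add: in_keys_iff)
  then have "u \<in> Poly_Mapping.keys (single_chain (monomial u) \<rho> \<rho> - kdiff n var d \<rho>)"
    by (simp add: in_keys_iff lookup_minus single_chain_def monomial_def)
  with d have "monomial u \<in> I" by (rule monomial_of_key_in_I)
  with assms show False by simp
qed

text \<open>
  The negation of the alternative (1) or (2) for \<open>p\<close>. Since \<open>lam\<close> itself has length at most
  \<open>\<lceil>p/2\<rceil>\<close>, failure of (2) turns minimality of \<open>part lam 1\<close> among the partitions of length at
  most \<open>\<lceil>p/2\<rceil>\<close> into minimality among those of length at most \<open>p\<close>.
\<close>

definition obstruction :: "nat \<Rightarrow> (nat \<Rightarrow>\<^sub>0 nat) \<Rightarrow> bool" where
  "obstruction p lam \<longleftrightarrow> lam \<in> L \<and> part_length lam \<le> p div 2 \<and> part lam 1 \<noteq> part lam 2 \<and>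
     (\<forall>\<mu>\<in>L. part_length \<mu> \<le> p \<longrightarrow> part lam 1 \<le> part \<mu> 1)"

lemma no_obstruction_iff:
  "(\<nexists>lam. obstruction p lam) \<longleftrightarrow>
     (\<forall>lam \<in> L.
        part_length lam \<le> p div 2 \<and>
        (\<forall>\<nu> \<in> L. part_length \<nu> \<le> (p + 1) div 2 \<longrightarrow> part lam 1 \<le> part \<nu> 1)
        \<longrightarrow> part lam 1 = part lam 2)
   \<or> (\<exists>\<mu> \<in> L.
        (p + 1) div 2 < part_length \<mu> \<and> part_length \<mu> \<le> p \<and>
        (\<forall>\<nu> \<in> L. part_length \<nu> \<le> (p + 1) div 2 \<longrightarrow> part \<mu> 1 < part \<nu> 1))"
  (is "?none \<longleftrightarrow> ?one \<or> ?two")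
proof
  assume none: ?none
  show "?one \<or> ?two"
  proof (rule disjCI, rule ballI, rule impI, rule ccontr)
    fix lam
    assume two: "\<not> ?two" and lam: "lam \<in> L" "part lam 1 \<noteq> part lam 2"
      and min: "part_length lam \<le> p div 2 \<and>
        (\<forall>\<nu> \<in> L. part_length \<nu> \<le> (p + 1) div 2 \<longrightarrow> part lam 1 \<le> part \<nu> 1)"
    have "part lam 1 \<le> part \<mu> 1" if \<mu>: "\<mu> \<in> L" "part_length \<mu> \<le> p" for \<mu>
    proof (cases "part_length \<mu> \<le> (p + 1) div 2")
      case True
      then show ?thesis using min \<mu> by blast
    next
      case False
      then obtain \<nu> where "\<nu> \<in> L" "part_length \<nu> \<le> (p + 1) div 2" "part \<nu> 1 \<le> part \<mu> 1"
        using two \<mu> by (meson not_le)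
      then show ?thesis using min by (meson order_trans)
    qed
    then have "obstruction p lam" using lam min unfolding obstruction_def by blast
    then show False using none by blast
  qed
next
  assume *: "?one \<or> ?two"
  show ?none
  proof
    assume "\<exists>lam. obstruction p lam"
    then obtain lam where lam: "lam \<in> L" "part_length lam \<le> p div 2" "part lam 1 \<noteq> part lam 2"
      and min: "\<And>\<mu>. \<mu> \<in> L \<Longrightarrow> part_length \<mu> \<le> p \<Longrightarrow> part lam 1 \<le> part \<mu> 1"
      unfolding obstruction_def by blast
    have "\<forall>\<nu> \<in> L. part_length \<nu> \<le> (p + 1) div 2 \<longrightarrow> part lam 1 \<le> part \<nu> 1"
      using min by auto
    then have "\<not> ?one" using lam by blast
    moreover have "\<not> ?two"
    proof
      assume ?two
      then obtain \<mu> where \<mu>: "\<mu> \<in> L" "part_length \<mu> \<le> p"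
        "\<And>\<nu>. \<nu> \<in> L \<Longrightarrow> part_length \<nu> \<le> (p + 1) div 2 \<Longrightarrow> part \<mu> 1 < part \<nu> 1" by blast
      \<comment> \<open>The floor bounds the length of \<open>lam\<close> and the ceiling appears in
        (2), so \<open>lam\<close> is among the partitions with which \<open>\<mu>\<close> is
        compared.\<close>
      have "part_length lam \<le> (p + 1) div 2" using lam(2) by linarith
      with \<mu>(3)[OF lam(1)] min[OF \<mu>(1,2)] show False by simp
    qed
    ultimately show False using * by blast
  qed
qed

section \<open>Boxes and generating partitions\<close>

lemma part_eq_zero:
  assumes "lam \<in> L" "i \<notin> {1..part_length lam}"
  shows "part lam i = 0"
  using partition_support[OF generating_partitionD(1)[OF assms(1)]] assms(2) by blast

lemma const_exp_exponents: "\<rho> \<subseteq> {1..n} \<Longrightarrow> const_exp \<rho> c \<in> exponents n"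
  by (rule exponentsI) (auto simp: lookup_const_exp finite_subset)

text \<open>The partition is placed with its first term at j, where the exponent is c + 1. Its other
  nonzero terms fall on the rest of \<open>\<rho>\<close> and are at most the second term, hence at
  most c.\<close>

lemma box_times_var_in_I:
  assumes \<rho>: "\<rho> \<subseteq> {1..n}" "j \<in> \<rho>" and lam: "lam \<in> L" "part_length lam \<le> card \<rho>"
    and bound: "part lam 1 \<le> Suc c" "part lam 2 \<le> c"
  shows "monomial (const_exp \<rho> c + unit_exp j) \<in> I"
proof -
  have fin: "finite \<rho>" using \<rho> finite_subset by blast
  obtain \<pi> where \<pi>: "\<pi> permutes {1..n}" "\<pi> ` \<rho> = {1..card \<rho>}" "\<pi> j = 1"
    using ex_permutation_onto_initial_segment[OF \<rho>] by blast
  note inj = permutes_inj[OF \<pi>(1)]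
  show ?thesis
  proof (rule monomial_permute_le[OF generating_partitionD(3)[OF lam(1)] \<pi>(1)])
    show "const_exp \<rho> c + unit_exp j \<in> exponents n"
      using \<rho> by (intro exponents_add const_exp_exponents exponents_single) auto
    fix k
    consider "k = j" | "k \<in> \<rho>" "k \<noteq> j" | "k \<notin> \<rho>" by blast
    then show "part lam (\<pi> k) \<le> Poly_Mapping.lookup (const_exp \<rho> c + unit_exp j) k"
    proof cases
      case 1
      then show ?thesis
        using \<rho> bound \<pi> by (simp add: lookup_add lookup_const_exp fin lookup_unit_exp)
    next
      case 2
      then have "\<pi> k \<in> {1..card \<rho>}" "\<pi> k \<noteq> 1"
        using \<pi> inj by (blast, metis injD)
      then have "part lam (\<pi> k) \<le> part lam 2"
        by (intro partition_antimono[OF generating_partitionD(1)[OF lam(1)]]) auto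
      then show ?thesis
        using 2 bound by (simp add: lookup_add lookup_const_exp fin)
    next
      case 3
      then have "\<pi> k \<notin> {1..card \<rho>}" using \<pi>(2) inj by (metis image_iff injD)
      then have "part lam (\<pi> k) = 0" using lam by (intro part_eq_zero) auto
      then show ?thesis by simp
    qed
  qed
qed

text \<open>A partition fits into a box after a permutation exactly when its number of nonzero terms
  and its largest term do; their arrangement is immaterial because a box is constant on its
  support.\<close>

lemma box_in_I_iff:
  assumes \<rho>: "\<rho> \<subseteq> {1..n}" "\<rho> \<noteq> {}"
  shows "monomial (const_exp \<rho> c) \<in> I \<longleftrightarrow> (\<exists>\<mu>\<in>L. part_length \<mu> \<le> card \<rho> \<and> part \<mu> 1 \<le> c)"
proof
  have fin: "finite \<rho>" using \<rho> finite_subset by blast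
  assume "monomial (const_exp \<rho> c) \<in> I"
  then obtain \<mu> \<pi> where \<mu>: "\<mu> \<in> L" and \<pi>: "\<pi> permutes {1..n}"
    and le: "\<And>i. part \<mu> (\<pi> i) \<le> Poly_Mapping.lookup (const_exp \<rho> c) i"
    using ex_generating_partition[OF const_exp_exponents[OF \<rho>(1)]] by blast
  have "{i. part \<mu> i \<noteq> 0} \<subseteq> \<pi> ` \<rho>"
  proof
    fix i assume i: "i \<in> {i. part \<mu> i \<noteq> 0}"
    obtain k where k: "i = \<pi> k" using permutes_surj[OF \<pi>] by (metis surjD)
    with i le[of k] have "k \<in> \<rho>" by (auto simp: lookup_const_exp fin split: if_splits)
    then show "i \<in> \<pi> ` \<rho>" using k by blast
  qed
  then have "card {i. part \<mu> i \<noteq> 0} \<le> card (\<pi> ` \<rho>)" using fin by (intro card_mono) auto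
  also have "\<dots> \<le> card \<rho>" by (rule card_image_le[OF fin])
  finally have "part_length \<mu> \<le> card \<rho>"
    using card_partition_support[OF generating_partitionD(1)[OF \<mu>]] by simp
  moreover have "part \<mu> 1 \<le> c"
  proof -
    obtain k where "1 = \<pi> k" using permutes_surj[OF \<pi>] by (metis surjD)
    with le[of k] show ?thesis by (simp add: lookup_const_exp fin split: if_splits)
  qed
  ultimately show "\<exists>\<mu>\<in>L. part_length \<mu> \<le> card \<rho> \<and> part \<mu> 1 \<le> c" using \<mu> by blast
next
  have fin: "finite \<rho>" using \<rho> finite_subset by blast
  assume "\<exists>\<mu>\<in>L. part_length \<mu> \<le> card \<rho> \<and> part \<mu> 1 \<le> c"
  then obtain \<mu> where \<mu>: "\<mu> \<in> L" "part_length \<mu> \<le> card \<rho>" "part \<mu> 1 \<le> c" by blast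
  obtain j where j: "j \<in> \<rho>" using \<rho>(2) by blast
  obtain \<pi> where \<pi>: "\<pi> permutes {1..n}" "\<pi> ` \<rho> = {1..card \<rho>}"
    using ex_permutation_onto_initial_segment[OF \<rho>(1) j] by blast
  show "monomial (const_exp \<rho> c) \<in> I"
  proof (rule monomial_permute_le[OF generating_partitionD(3)[OF \<mu>(1)] \<pi>(1)])
    fix k
    show "part \<mu> (\<pi> k) \<le> Poly_Mapping.lookup (const_exp \<rho> c) k"
    proof (cases "k \<in> \<rho>")
      case True
      then have "\<pi> k \<in> {1..card \<rho>}" using \<pi> by blast
      then have "part \<mu> (\<pi> k) \<le> part \<mu> 1"
        by (intro partition_antimono[OF generating_partitionD(1)[OF \<mu>(1)]]) auto
      then show ?thesis using True \<mu>(3) by (simp add: lookup_const_exp fin)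
    next
      case False
      then have "\<pi> k \<notin> {1..card \<rho>}" using \<pi>(2) permutes_inj[OF \<pi>(1)] by (metis image_iff injD)
      then have "part \<mu> (\<pi> k) = 0" using \<mu> by (intro part_eq_zero) auto
      then show ?thesis by simp
    qed
  qed (rule const_exp_exponents[OF \<rho>(1)])
qed

lemma const_exp_Un:
  assumes "finite \<sigma>" "finite \<tau>" "\<sigma> \<inter> \<tau> = {}"
  shows "const_exp \<sigma> c + const_exp \<tau> c = const_exp (\<sigma> \<union> \<tau>) c"
  using assms by (intro poly_mapping_eqI) (auto simp: lookup_add lookup_const_exp)

lemma obstruction_imp_not_vanish:
  assumes p: "p \<in> {2..n}" and obs: "obstruction p lam"
  shows "\<not> monomial_cycle_products_vanish n I"
proof
  assume vanish: "monomial_cycle_products_vanish n I"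
  have lam: "lam \<in> L" "part_length lam \<le> p div 2" "part lam 1 \<noteq> part lam 2"
    and min: "\<And>\<mu>. \<mu> \<in> L \<Longrightarrow> part_length \<mu> \<le> p \<Longrightarrow> part lam 1 \<le> part \<mu> 1"
    using obs unfolding obstruction_def by blast+
  have "part lam 2 \<le> part lam 1"
    by (rule partition_antimono[OF generating_partitionD(1)[OF lam(1)]]) auto
  \<comment> \<open>A weakly decreasing partition with distinct first two terms has a positive first
    term; c is that term minus 1.\<close>
  then obtain c where c: "part lam 1 = Suc c" "part lam 2 \<le> c"
    using lam(3) by (cases "part lam 1") auto
  define \<sigma> where "\<sigma> = {1..p div 2}"
  define \<tau> where "\<tau> = {Suc (p div 2)..p}"
  have st: "\<sigma> \<subseteq> {1..n}" "\<tau> \<subseteq> {1..n}" "\<sigma> \<inter> \<tau> = {}" "\<sigma> \<noteq> {}" "\<tau> \<noteq> {}"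
    and un: "\<sigma> \<union> \<tau> = {1..p}"
    using p by (auto simp: \<sigma>_def \<tau>_def)
  \<comment> \<open>\<open>\<tau>\<close> has p - p div 2 elements, at least as many as
    \<open>\<sigma>\<close>, so the bound p div 2 serves both halves.\<close>
  have card: "part_length lam \<le> card \<sigma>" "part_length lam \<le> card \<tau>"
    using lam(2) by (simp_all add: \<sigma>_def \<tau>_def)
  have "\<forall>i\<in>\<sigma>. var i * monomial (const_exp \<sigma> c) \<in> I"
    using box_times_var_in_I[OF st(1) _ lam(1) card(1)] c by (simp add: var_mult_monomial)
  moreover have "\<forall>j\<in>\<tau>. var j * monomial (const_exp \<tau> c) \<in> I"
    using box_times_var_in_I[OF st(2) _ lam(1) card(2)] c by (simp add: var_mult_monomial)
  ultimately have "single_chain (monomial (const_exp \<sigma> c + const_exp \<tau> c)) (\<sigma> \<union> \<tau>) \<in> boundaries"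
    using vanish[unfolded products_vanish_iff, rule_format,
        of "const_exp \<sigma> c" "const_exp \<tau> c" \<sigma> \<tau>] st
    by (simp add: const_exp_exponents)
  then have "single_chain (monomial (const_exp {1..p} c)) {1..p} \<in> boundaries"
    using st by (simp add: const_exp_Un finite_subset un)
  moreover have "monomial (const_exp {1..p} c) \<notin> I"
  proof (subst box_in_I_iff)
    \<comment> \<open>A partition fitting into this box would have length at most p and first term
      below that of \<open>lam\<close>.\<close>
    show "\<not> (\<exists>\<mu>\<in>L. part_length \<mu> \<le> card {1..p} \<and> part \<mu> 1 \<le> c)"
      using min c(1) by fastforce
  qed (use p in auto)
  then have "single_chain (monomial (const_exp {1..p} c)) {1..p} \<notin> boundaries"
    using p by (intro single_chain_not_boundary const_exp_exponents) (auto simp: lookup_const_exp)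
  ultimately show False by blast
qed

text \<open>The partition is found below a x_i, where a is the box on the smaller set; this is why
  its length is at most p div 2. Its shape is forced, because x_i is the only variable with exponent
  c + 1.\<close>

lemma ex_obstruction_of_boxes:
  assumes st: "\<sigma> \<subseteq> {1..n}" "\<tau> \<subseteq> {1..n}" "\<sigma> \<inter> \<tau> = {}" "card \<sigma> \<le> card \<tau>"
    and i: "i \<in> \<sigma>" "monomial (const_exp \<sigma> c + unit_exp i) \<in> I"
    and not_in: "monomial (const_exp (\<sigma> \<union> \<tau>) c) \<notin> I"
  shows "\<exists>p\<in>{2..n}. \<exists>lam. obstruction p lam"
proof -
  have fin: "finite \<sigma>" "finite \<tau>" using st finite_subset by blast+
  define p where "p = card (\<sigma> \<union> \<tau>)"
  have p: "p = card \<sigma> + card \<tau>" using fin st by (simp add: p_def card_Un_disjoint)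
  have "card \<sigma> > 0" using i fin by (auto simp: card_gt_0_iff)
  moreover have "p \<le> n" using card_mono[of "{1..n}" "\<sigma> \<union> \<tau>"] st by (simp add: p_def)
  ultimately have pn: "p \<in> {2..n}" using st(4) p by auto
  have i': "i \<in> {1..n}" using i st by blast
  let ?a = "const_exp \<sigma> c + unit_exp i"
  have a: "Poly_Mapping.lookup ?a k = (if k \<in> \<sigma> then c else 0) + (if k = i then 1 else 0)" for k
    by (simp add: lookup_add lookup_const_exp fin lookup_unit_exp)
  obtain lam \<pi> where lam: "lam \<in> L" and \<pi>: "\<pi> permutes {1..n}"
    and le: "\<And>k. part lam (\<pi> k) \<le> Poly_Mapping.lookup ?a k"
    using ex_generating_partition[OF exponents_add[OF const_exp_exponents[OF st(1)]
          exponents_single[OF i']] i(2)] by blast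
  have "{j. part lam j \<noteq> 0} \<subseteq> \<pi> ` \<sigma>"
  proof
    fix j assume j: "j \<in> {j. part lam j \<noteq> 0}"
    obtain k where k: "j = \<pi> k" using permutes_surj[OF \<pi>] by (metis surjD)
    with j le[of k] i have "k \<in> \<sigma>" by (auto simp: a split: if_splits)
    then show "j \<in> \<pi> ` \<sigma>" using k by blast
  qed
  then have "card {j. part lam j \<noteq> 0} \<le> card (\<pi> ` \<sigma>)" using fin by (intro card_mono) auto
  also have "\<dots> \<le> card \<sigma>" by (rule card_image_le[OF fin(1)])
  finally have len: "part_length lam \<le> card \<sigma>"
    using card_partition_support[OF generating_partitionD(1)[OF lam]] by simp
  \<comment> \<open>The criterion for boxes applied to the union, which has p elements.\<close>
  have min: "Suc c \<le> part \<mu> 1" if "\<mu> \<in> L" "part_length \<mu> \<le> p" for \<mu>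
    using not_in that i st by (subst (asm) box_in_I_iff) (auto simp: p_def not_le Suc_le_eq)
  obtain k1 where k1: "1 = \<pi> k1" using permutes_surj[OF \<pi>] by (metis surjD)
  obtain k2 where k2: "2 = \<pi> k2" using permutes_surj[OF \<pi>] by (metis surjD)
  have "k1 \<noteq> k2" using k1 k2 by auto
  have "part lam 1 \<le> Suc c" using le[of k1] by (auto simp: k1[symmetric] a split: if_splits)
  moreover have "Suc c \<le> part lam 1" using min[OF lam] len p by simp
  ultimately have lam1: "part lam 1 = Suc c" by simp
  \<comment> \<open>The first term c + 1 fits only at i, so the second term is placed elsewhere and
    is bounded by c.\<close>
  have "k1 = i" using le[of k1] lam1 by (auto simp: k1[symmetric] a split: if_splits)
  then have "part lam 2 \<le> c"
    using le[of k2] \<open>k1 \<noteq> k2\<close> by (auto simp: k2[symmetric] a split: if_splits)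
  then have "obstruction p lam"
    unfolding obstruction_def using lam len p st(4) lam1 min by auto
  then show ?thesis using pn by blast
qed

section \<open>From a nonzero product to two boxes\<close>

lemma transpose_permutes: "i \<in> {1..n} \<Longrightarrow> l \<in> {1..n} \<Longrightarrow> transpose i l permutes {1..n}"
  by (rule permutes_swap_id)

text \<open>If x_i divided x^b, then x^a x_i, which lies in I, would divide the product.\<close>

lemma disjoint_support_if_product_notin_I:
  assumes "b \<in> exponents n" "i \<in> \<sigma>" "monomial (a + unit_exp i) \<in> I"
    and "a \<in> exponents n" "monomial (a + b) \<notin> I"
  shows "Poly_Mapping.lookup b i = 0"
proof (rule ccontr)
  assume pos: "Poly_Mapping.lookup b i \<noteq> 0"
  have "monomial (a + b) \<in> I"
    by (rule monomial_upward_closed[OF assms(3)])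
      (use pos assms in \<open>auto simp: exponents_add lookup_add lookup_unit_exp\<close>)
  then show False using assms by blast
qed

text \<open>
  If the exponent of \<open>b\<close> at \<open>l\<close> exceeded that of \<open>a\<close> at \<open>i\<close>, the power of \<open>x\<^sub>i\<close> in \<open>x\<^sup>a x\<^sub>i \<in> I\<close>
  could be traded for the power of \<open>x\<^sub>l\<close> already present in \<open>x\<^sup>b\<close>.
\<close>

lemma exponent_dominates:
  assumes ab: "a \<in> exponents n" "b \<in> exponents n"
    and i: "i \<in> {1..n}" "monomial (a + unit_exp i) \<in> I"
    and not_in: "monomial (a + b) \<notin> I"
    and al: "Poly_Mapping.lookup b l > 0 \<Longrightarrow> Poly_Mapping.lookup a l = 0"
  shows "Poly_Mapping.lookup b l \<le> Poly_Mapping.lookup a i"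
proof (rule ccontr)
  assume gt: "\<not> ?thesis"
  then have l: "l \<in> {1..n}" using lookup_exponents_outside[OF ab(2)] by fastforce
  have al: "Poly_Mapping.lookup a l = 0" using al gt by simp
  have "monomial (a + b) \<in> I"
  proof (rule monomial_permute_le[OF i(2) transpose_permutes[OF i(1) l]])
    show "a + b \<in> exponents n" using ab by (rule exponents_add)
    fix k
    show "Poly_Mapping.lookup (a + unit_exp i) (transpose i l k) \<le> Poly_Mapping.lookup (a + b) k"
      using gt al by (cases "k = i"; cases "k = l") (auto simp: lookup_add lookup_unit_exp)
  qed
  then show False using not_in by blast
qed

lemma not_vanish_imp_obstruction:
  assumes "\<not> monomial_cycle_products_vanish n I"
  shows "\<exists>p\<in>{2..n}. \<exists>lam. obstruction p lam"
proof -
  obtain a b \<sigma> \<tau> where ab: "a \<in> exponents n" "b \<in> exponents n"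
    and st: "\<sigma> \<subseteq> {1..n}" "\<tau> \<subseteq> {1..n}" "\<sigma> \<noteq> {}" "\<tau> \<noteq> {}" "\<sigma> \<inter> \<tau> = {}"
    and sI: "\<And>i. i \<in> \<sigma> \<Longrightarrow> monomial (a + unit_exp i) \<in> I"
    and tI: "\<And>j. j \<in> \<tau> \<Longrightarrow> monomial (b + unit_exp j) \<in> I"
    and nb: "single_chain (monomial (a + b)) (\<sigma> \<union> \<tau>) \<notin> boundaries"
    using assms unfolding products_vanish_iff var_mult_monomial by blast
  note uE = exponents_add[OF ab]
  have not_in: "monomial (a + b) \<notin> I"
    using nb single_chain_boundary_if_in_I[OF _ uE] by blast
  then have not_in': "monomial (b + a) \<notin> I" by (simp add: add.commute)
  have bs: "Poly_Mapping.lookup b i = 0" if "i \<in> \<sigma>" for i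
    using disjoint_support_if_product_notin_I[OF ab(2) that sI[OF that] ab(1) not_in] .
  have at: "Poly_Mapping.lookup a j = 0" if "j \<in> \<tau>" for j
    using disjoint_support_if_product_notin_I[OF ab(1) that tI[OF that] ab(2) not_in'] .
  \<comment> \<open>The exchange criterion in contrapositive form: for every variable x_l outside
    \<open>\<sigma> \<union> \<tau>\<close> that divides u, some u x_i / x_l stays outside I. The
    contradictions below consist in placing all of these in I.\<close>
  have nex: "\<exists>i\<in>\<sigma> \<union> \<tau>. monomial (a + b + unit_exp i - unit_exp l) \<notin> I"
    if "l \<in> {1..n} - (\<sigma> \<union> \<tau>)" "Poly_Mapping.lookup (a + b) l > 0" for l
    using single_chain_boundary_if_exchange[OF uE _ that] nb st by blast
  \<comment> \<open>When b contains x_l, the division can be charged to b, and a x_i still divides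
    the quotient.\<close>
  have keepa: "monomial (a + b + unit_exp i - unit_exp l) \<in> I"
    if "i \<in> \<sigma>" "Poly_Mapping.lookup b l > 0" for i l
    by (rule monomial_upward_closed[OF sI[OF that(1)]])
      (use that st ab in \<open>auto simp: lookup_add lookup_minus lookup_unit_exp
        intro!: exponents_minus exponents_add exponents_single\<close>)
  have keepb: "monomial (a + b + unit_exp j - unit_exp l) \<in> I"
    if "j \<in> \<tau>" "Poly_Mapping.lookup a l > 0" for j l
    by (rule monomial_upward_closed[OF tI[OF that(1)]])
      (use that st ab in \<open>auto simp: lookup_add lookup_minus lookup_unit_exp
        intro!: exponents_minus exponents_add exponents_single\<close>)
  \<comment> \<open>For a variable dividing both a and b the division can be charged to either
    factor, which settles the indices of both \<open>\<sigma>\<close> and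
    \<open>\<tau>\<close>.\<close>
  have disj: "Poly_Mapping.lookup a l = 0 \<or> Poly_Mapping.lookup b l = 0" for l
  proof (rule ccontr)
    assume l: "\<not> ?thesis"
    then have "l \<in> {1..n} - (\<sigma> \<union> \<tau>)"
      using bs at lookup_exponents_outside[OF ab(1), of l] by auto
    from nex[OF this] l keepa keepb show False by (auto simp: lookup_add)
  qed
  obtain i0 j0 where i0: "i0 \<in> \<sigma>" and j0: "j0 \<in> \<tau>" using st by blast
  have ble: "Poly_Mapping.lookup b l \<le> Poly_Mapping.lookup a i" if "i \<in> \<sigma>" for i l
    by (rule exponent_dominates[OF ab _ sI[OF that] not_in]) (use that st disj[of l] in auto)
  have ale: "Poly_Mapping.lookup a l \<le> Poly_Mapping.lookup b j" if "j \<in> \<tau>" for j l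
    by (rule exponent_dominates[OF ab(2,1) _ tI[OF that] not_in']) (use that st disj[of l] in auto)
  define c where "c = Poly_Mapping.lookup a i0"
  \<comment> \<open>The inequalities \<open>ble\<close> and \<open>ale\<close> hold for every pair
    of indices in \<open>\<sigma>\<close> and \<open>\<tau>\<close>, so all the exponents concerned
    coincide.\<close>
  have ac: "Poly_Mapping.lookup a i = c" if "i \<in> \<sigma>" for i
    using ble[OF that, of j0] ale[OF j0, of i] ble[OF i0, of j0] ale[OF j0, of i0]
    unfolding c_def by linarith
  have bc: "Poly_Mapping.lookup b j = c" if "j \<in> \<tau>" for j
    using ble[OF i0, of j] ale[OF that, of i0] unfolding c_def by linarith
  \<comment> \<open>Indices in \<open>\<tau>\<close> are settled by \<open>keepb\<close>. For i in
    \<open>\<sigma>\<close> the lost power of x_l is recovered from x_j0: a vanishes at j0, and by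
    \<open>ale\<close> the exponent of b there is at least that of a at l.\<close>
  have aout: "Poly_Mapping.lookup a l = 0" if l: "l \<notin> \<sigma>" for l
  proof (rule ccontr)
    assume pos: "Poly_Mapping.lookup a l \<noteq> 0"
    then have l': "l \<in> {1..n} - (\<sigma> \<union> \<tau>)"
      using l at lookup_exponents_outside[OF ab(1), of l] by auto
    have "monomial (a + b + unit_exp i - unit_exp l) \<in> I" if i: "i \<in> \<sigma>" for i
    proof (rule monomial_permute_le[OF sI[OF i], of "transpose l j0"])
      show "transpose l j0 permutes {1..n}"
        using l' j0 st by (intro transpose_permutes) auto
      show "a + b + unit_exp i - unit_exp l \<in> exponents n"
        using i st ab by (auto intro!: exponents_minus exponents_add exponents_single)
      fix k
      have "l \<noteq> i" "j0 \<noteq> i" "l \<noteq> j0" using l' i j0 st by auto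
      then show "Poly_Mapping.lookup (a + unit_exp i) (transpose l j0 k)
          \<le> Poly_Mapping.lookup (a + b + unit_exp i - unit_exp l) k"
        using at[OF j0] ale[OF j0, of l]
        by (cases "k = l"; cases "k = j0") (auto simp: lookup_add lookup_minus lookup_unit_exp)
    qed
    with nex[OF l'] pos keepb show False by (auto simp: lookup_add)
  qed
  have bout: "Poly_Mapping.lookup b l = 0" if l: "l \<notin> \<tau>" for l
  proof (rule ccontr)
    assume pos: "Poly_Mapping.lookup b l \<noteq> 0"
    then have l': "l \<in> {1..n} - (\<sigma> \<union> \<tau>)"
      using l bs lookup_exponents_outside[OF ab(2), of l] by auto
    have "monomial (a + b + unit_exp j - unit_exp l) \<in> I" if j: "j \<in> \<tau>" for j
    proof (rule monomial_permute_le[OF tI[OF j], of "transpose l i0"])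
      show "transpose l i0 permutes {1..n}"
        using l' i0 st by (intro transpose_permutes) auto
      show "a + b + unit_exp j - unit_exp l \<in> exponents n"
        using j st ab by (auto intro!: exponents_minus exponents_add exponents_single)
      fix k
      have "l \<noteq> j" "i0 \<noteq> j" "l \<noteq> i0" using l' j i0 st by auto
      then show "Poly_Mapping.lookup (b + unit_exp j) (transpose l i0 k)
          \<le> Poly_Mapping.lookup (a + b + unit_exp j - unit_exp l) k"
        using bs[OF i0] ble[OF i0, of l]
        by (cases "k = l"; cases "k = i0") (auto simp: lookup_add lookup_minus lookup_unit_exp)
    qed
    with nex[OF l'] pos keepa show False by (auto simp: lookup_add)
  qed
  have fin: "finite \<sigma>" "finite \<tau>" using st finite_subset by blast+
  have a: "a = const_exp \<sigma> c" and b: "b = const_exp \<tau> c"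
    by (rule poly_mapping_eqI; simp add: lookup_const_exp fin ac bc aout bout)+
  have "a + b = const_exp (\<sigma> \<union> \<tau>) c" unfolding a b by (rule const_exp_Un) fact+
  with not_in have not_in: "monomial (const_exp (\<sigma> \<union> \<tau>) c) \<notin> I" by simp
  show ?thesis
  \<comment> \<open>The situation is symmetric in the two cycles; the smaller box has to come
    first.\<close>
  proof (cases "card \<sigma> \<le> card \<tau>")
    case True
    show ?thesis
      using ex_obstruction_of_boxes[OF st(1,2,5) True i0] sI[OF i0] not_in by (simp add: a)
  next
    case False
    have "\<tau> \<inter> \<sigma> = {}" "card \<tau> \<le> card \<sigma>" using st False by auto
    then show ?thesis
      using ex_obstruction_of_boxes[OF st(2,1) _ _ j0] tI[OF j0] not_in by (simp add: b Un_commute)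
  qed
qed

lemma products_vanish_iff_no_obstruction:
  "monomial_cycle_products_vanish n I \<longleftrightarrow> (\<forall>p\<in>{2..n}. \<nexists>lam. obstruction p lam)"
  using obstruction_imp_not_vanish not_vanish_imp_obstruction by blast

end

theorem theorem1p7:
  fixes n :: nat and I :: "('k::field mpoly) set"
  assumes "symmetric_monomial_ideal n I"
    and "I \<subseteq> max_ideal n \<cdot>\<^bsub>mpoly_ring n\<^esub> max_ideal n"
  shows "monomial_cycle_products_vanish n I \<longleftrightarrow>
    (\<forall>p \<in> {2..n}.
       (\<forall>lam \<in> generating_partitions n I.
          part_length lam \<le> p div 2 \<and>
          (\<forall>\<nu> \<in> generating_partitions n I.
             part_length \<nu> \<le> (p + 1) div 2 \<longrightarrow> part lam 1 \<le> part \<nu> 1)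
          \<longrightarrow> part lam 1 = part lam 2)
     \<or> (\<exists>\<mu> \<in> generating_partitions n I.
          (p + 1) div 2 < part_length \<mu> \<and> part_length \<mu> \<le> p \<and>
          (\<forall>\<nu> \<in> generating_partitions n I.
             part_length \<nu> \<le> (p + 1) div 2 \<longrightarrow> part \<mu> 1 < part \<nu> 1)))"
proof -
  have mono: "monomial_ideal n I"
    and sym: "\<And>\<pi>. \<pi> permutes {1..n} \<Longrightarrow> permute_vars \<pi> ` I \<subseteq> I"
    using assms(1) unfolding symmetric_monomial_ideal_def by blast+
  interpret symmetric_quotient n I
    by (intro symmetric_quotient.intro mpoly_quotient.intro symmetric_quotient_axioms.intro
        monomial_ideal_imp_ideal mono sym)
  show ?thesis
    unfolding products_vanish_iff_no_obstruction no_obstruction_iff ..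
qed

end
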